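(* Let $f:\mathbb{B}^n\to\mathbb{B}^N$ be a minimal completely non-rational proper holomorphic map. Then $\Gamma_f$ and $T_f$ are either both finite or both noncompact.
   Context: $\mathbb{B}^k$ is the open unit ball in $\mathbb{C}^k$ and $\mathrm{Aut}(\mathbb{B}^k)$ is its group of holomorphic automorphisms (with its usual Lie group topology). For holomorphic $f:\mathbb{B}^n\to\mathbb{B}^N$, let $A_f$ be the group of pairs $(\gamma,\psi)\in \mathrm{Aut}(\mathbb{B}^n)\times\mathrm{Aut}(\mathbb{B}^N)$ with $f\circ\gamma=\psi\circ f$; $\Gamma_f$ and $T_f$ are the projections of $A_f$ to the first and second factors. The map $f$ is minimal if its image lies in no affine linear subspace of $\mathbb{C}^N$ of dimension less than $N$. A proper holomorphic map $f:\mathbb{B}^n\to\mathbb{B}^N$ is completely non-rational if, for each positive-dimensional (complex) affine linear subspace $V$ of $\mathbb{C}^n$ (meeting $\mathbb{B}^n$), the restriction of $f$ to $V\cap\mathbb{B}^n$ is not a rational map. *)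

theory Defs
  imports "HOL-Analysis.Analysis"
begin

abbreviation unit_ball :: "(complex ^ 'n) set"
  where "unit_ball \<equiv> ball 0 1"

text \<open>
  Holomorphic means complex (Frechet) differentiable: the real derivative exists and is
  \<open>\<complex>\<close>-linear.
\<close>

definition holomorphic_map_on :: "(complex ^ 'n \<Rightarrow> complex ^ 'm) \<Rightarrow> (complex ^ 'n) set \<Rightarrow> bool"
  where "holomorphic_map_on f S \<longleftrightarrow>
    (\<forall>z\<in>S. \<exists>D. (f has_derivative D) (at z within S) \<and> Vector_Spaces.linear (*s) (*s) D)"

text \<open>
  Automorphisms are maps of the ball only; they are represented by functions that take the value
  \<open>undefined\<close> off the ball, so that equality of functions is equality of automorphisms and
  cardinalities are meaningful.
\<close>

definition ball_aut :: "(complex ^ 'n \<Rightarrow> complex ^ 'n) set"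
  where "ball_aut = {g. g \<in> extensional unit_ball \<and> bij_betw g unit_ball unit_ball \<and>
    holomorphic_map_on g unit_ball \<and> holomorphic_map_on (the_inv_into unit_ball g) unit_ball}"

text \<open>
  The Lie group topology of the automorphism group of the ball is the compact-open topology,
  that is, the topology of uniform convergence on compact subsets of the ball.
\<close>

definition ball_aut_topology :: "(complex ^ 'n \<Rightarrow> complex ^ 'n) topology"
  where "ball_aut_topology = topology_generated_by
    {{g \<in> ball_aut. g ` K \<subseteq> U} | K U. compact K \<and> K \<subseteq> unit_ball \<and> open U}"

lemma topspace_ball_aut_topology: "topspace ball_aut_topology = ball_aut"
proof -
  have "(ball_aut :: (complex ^ 'n \<Rightarrow> complex ^ 'n) set)
      \<in> {{g \<in> ball_aut. g ` K \<subseteq> U} | K U. compact K \<and> K \<subseteq> unit_ball \<and> open U}"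
    by (rule CollectI, rule exI[of _ "{}"], rule exI[of _ "{}"]) simp
  then show ?thesis
    unfolding ball_aut_topology_def topology_generated_by_topspace by blast
qed

definition A_grp ::
  "(complex ^ 'n \<Rightarrow> complex ^ 'm) \<Rightarrow> ((complex ^ 'n \<Rightarrow> complex ^ 'n) \<times> (complex ^ 'm \<Rightarrow> complex ^ 'm)) set"
  where "A_grp f = {(\<gamma>, \<psi>). \<gamma> \<in> ball_aut \<and> \<psi> \<in> ball_aut \<and> (\<forall>z\<in>unit_ball. f (\<gamma> z) = \<psi> (f z))}"

definition Gamma_grp :: "(complex ^ 'n \<Rightarrow> complex ^ 'm) \<Rightarrow> (complex ^ 'n \<Rightarrow> complex ^ 'n) set"
  where "Gamma_grp f = fst ` A_grp f"

definition T_grp :: "(complex ^ 'n \<Rightarrow> complex ^ 'm) \<Rightarrow> (complex ^ 'm \<Rightarrow> complex ^ 'm) set"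
  where "T_grp f = snd ` A_grp f"

definition complex_affine_dim :: "(complex ^ 'n) set \<Rightarrow> nat \<Rightarrow> bool"
  where "complex_affine_dim V d \<longleftrightarrow>
    (\<exists>a W. vec.subspace W \<and> vec.dim W = d \<and> V = (\<lambda>w. a + w) ` W)"

definition minimal_map :: "(complex ^ 'n \<Rightarrow> complex ^ 'm) \<Rightarrow> bool"
  where "minimal_map f \<longleftrightarrow>
    \<not> (\<exists>V d. complex_affine_dim V d \<and> d < CARD('m) \<and> f ` unit_ball \<subseteq> V)"

definition proper_holomorphic_map :: "(complex ^ 'n \<Rightarrow> complex ^ 'm) \<Rightarrow> bool"
  where "proper_holomorphic_map f \<longleftrightarrow>
    holomorphic_map_on f unit_ball \<and>
    proper_map (top_of_set unit_ball) (top_of_set unit_ball) f"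

text \<open>
  \<open>proper_map\<close> contains the requirement that \<open>f\<close> maps the ball into the ball, and for the
  continuous maps considered here it says that preimages of compact sets are compact.
\<close>

lemma proper_holomorphic_map_iff:
  fixes f :: "complex ^ 'n \<Rightarrow> complex ^ 'm"
  shows "proper_holomorphic_map f \<longleftrightarrow>
    holomorphic_map_on f unit_ball \<and> f ` unit_ball \<subseteq> unit_ball \<and>
    (\<forall>K. compact K \<and> K \<subseteq> unit_ball \<longrightarrow> compact {z \<in> unit_ball. f z \<in> K})"
proof (cases "holomorphic_map_on f unit_ball")
  case True
  have "k_space (top_of_set (unit_ball :: (complex ^ 'm) set))"
    by (simp add: metrizable_imp_k_space metrizable_space_subtopology metrizable_space_euclidean)
  moreover have "kc_space (top_of_set (unit_ball :: (complex ^ 'm) set))"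
      "kc_space (top_of_set (unit_ball :: (complex ^ 'n) set))"
    by (intro Hausdorff_imp_kc_space Hausdorff_space_subtopology; simp)+
  ultimately have "proper_map (top_of_set unit_ball) (top_of_set unit_ball) f \<longleftrightarrow>
      f \<in> unit_ball \<rightarrow> unit_ball \<and>
      (\<forall>K. compactin (top_of_set unit_ball) K \<longrightarrow>
        compactin (top_of_set unit_ball) {z \<in> unit_ball. f z \<in> K})"
    using proper_eq_compact_map[of "top_of_set (unit_ball :: (complex ^ 'm) set)"
        "top_of_set (unit_ball :: (complex ^ 'n) set)" f]
    by simp
  then show ?thesis
    using True by (auto simp: proper_holomorphic_map_def compactin_subtopology)
qed (simp add: proper_holomorphic_map_def)

definition polynomial_fun :: "(complex ^ 'n \<Rightarrow> complex) \<Rightarrow> bool"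
  where "polynomial_fun p \<longleftrightarrow>
    (\<exists>(A :: ('n \<Rightarrow> nat) set) c. finite A \<and> p = (\<lambda>z. \<Sum>\<alpha>\<in>A. c \<alpha> * (\<Prod>i\<in>UNIV. z $ i ^ \<alpha> i)))"

text \<open>
  Rationality is only used on sets \<open>S = V \<inter> unit_ball\<close> with \<open>V\<close> a complex affine subspace; every
  polynomial on \<open>V\<close> is the restriction of a polynomial in the ambient coordinates, and a
  polynomial that is not identically zero on \<open>S\<close> vanishes only on a nowhere dense subset of \<open>S\<close>.
\<close>

definition rational_map_on :: "(complex ^ 'n \<Rightarrow> complex ^ 'm) \<Rightarrow> (complex ^ 'n) set \<Rightarrow> bool"
  where "rational_map_on f S \<longleftrightarrow>
    (\<exists>p q. (\<forall>j. polynomial_fun (\<lambda>z. p z $ j)) \<and> polynomial_fun q \<and> (\<exists>z\<in>S. q z \<noteq> 0) \<and>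
      (\<forall>z\<in>S. q z \<noteq> 0 \<longrightarrow> f z = inverse (q z) *s p z))"

definition completely_nonrational :: "(complex ^ 'n \<Rightarrow> complex ^ 'm) \<Rightarrow> bool"
  where "completely_nonrational f \<longleftrightarrow>
    (\<forall>V d. complex_affine_dim V d \<and> d > 0 \<and> V \<inter> unit_ball \<noteq> {} \<longrightarrow>
      \<not> rational_map_on f (V \<inter> unit_ball))"

end

theory Submission
  imports Defs "HOL-Complex_Analysis.Conformal_Mappings"
begin

text \<open>
  Suppose that one of the two groups is compact. The orbit of \<open>0\<close> under \<open>Gamma_grp f\<close> is then bounded away
  from the sphere: this is continuity of evaluation at \<open>0\<close> when \<open>Gamma_grp f\<close> is compact, and when
  \<open>T_grp f\<close> is compact the orbit is carried by \<open>f\<close> into a compact set, so that properness applies. A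
  group of automorphisms with such an orbit fixes a point \<open>a\<close> of the ball, namely the centre of the smallest
  hyperbolic ball around the orbit (\<open>hyperbolic_circumcentre\<close>). The corresponding automorphisms of the
  target fix \<open>f a\<close>.

  Moving \<open>a\<close> and \<open>f a\<close> to the origins by involutions replaces \<open>f\<close> by a map \<open>F\<close> and the pairs in
  \<open>A_grp f\<close> by pairs of unitary matrices \<open>(A, B)\<close> with \<open>F \<circ> A = B \<circ> F\<close>, by Cartan's theorem
  (\<open>bihol_fixing_0_unitary\<close>). If there were infinitely many pairs, some would accumulate at the identity, and a
  rescaled limit would give a nonzero pair \<open>(X, Y)\<close> with \<open>X\<close> skew-Hermitian and
  \<open>F' (z) (X z) = Y (F z)\<close> on the ball (\<open>infinitesimal_symmetry\<close>).

  If \<open>X\<close> were zero, \<open>Y\<close> would annihilate the image of \<open>F\<close>, against minimality of \<open>f\<close>. So \<open>X\<close>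
  has an eigenvector \<open>v\<close> with eigenvalue \<open>\<mu> \<noteq> 0\<close>. On the line of \<open>v\<close> the function \<open>u t = F (t v)\<close>
  satisfies \<open>\<mu> t u' (t) = Y (u t)\<close>, so each Taylor coefficient of order \<open>k\<close> that does not vanish is an
  eigenvector of \<open>Y\<close> for the eigenvalue \<open>k \<mu>\<close>. As \<open>Y\<close> has only finitely many eigenvalues, \<open>u\<close>
  is a polynomial. Undoing the involutions, which are linear fractional and map lines to lines, makes \<open>f\<close>
  rational on a complex line through \<open>a\<close> (\<open>rational_on_line\<close>). This contradicts complete
  non-rationality. Hence \<open>A_grp f\<close> is finite, and so are its two projections.
\<close>

section \<open>The Hermitian form and the involutions of the ball\<close>

definition herm :: "complex ^ 'n \<Rightarrow> complex ^ 'n \<Rightarrow> complex"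
  where "herm z w = (\<Sum>i\<in>UNIV. z $ i * cnj (w $ i))"

lemma herm_add_left: "herm (x + y) w = herm x w + herm y w"
  by (simp add: herm_def algebra_simps sum.distrib)

lemma herm_diff_left: "herm (x - y) w = herm x w - herm y w"
  by (simp add: herm_def algebra_simps sum_subtractf)

lemma herm_add_right: "herm w (x + y) = herm w x + herm w y"
  by (simp add: herm_def algebra_simps sum.distrib)

lemma herm_diff_right: "herm w (x - y) = herm w x - herm w y"
  by (simp add: herm_def algebra_simps sum_subtractf)

lemma herm_scale_left: "herm (c *s x) w = c * herm x w"
  by (simp add: herm_def algebra_simps sum_distrib_left)

lemma herm_scale_right: "herm w (c *s x) = cnj c * herm w x"
  by (simp add: herm_def algebra_simps sum_distrib_left)

lemma herm_zero_left [simp]: "herm 0 w = 0"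
  by (simp add: herm_def)

lemma herm_zero_right [simp]: "herm w 0 = 0"
  by (simp add: herm_def)

lemmas herm_simps = herm_add_left herm_diff_left herm_add_right herm_diff_right
  herm_scale_left herm_scale_right

lemma cnj_herm: "cnj (herm z w) = herm w z"
  by (simp add: herm_def mult.commute)

lemma inner_eq_Re_herm: "inner z w = Re (herm z w)"
  by (simp add: herm_def inner_vec_def inner_complex_def)

lemma herm_self: "herm z z = of_real ((norm z)\<^sup>2)"
proof -
  have "Im (herm z z) = 0"
    using cnj_herm[of z z] by (metis Reals_cnj_iff complex_is_Real_iff)
  moreover have "Re (herm z z) = (norm z)\<^sup>2"
    by (metis inner_eq_Re_herm power2_norm_eq_inner)
  ultimately show ?thesis by (simp add: complex_eq_iff)
qed

lemma norm_scale: "norm (c *s (z :: complex ^ 'n)) = cmod c * norm z"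
proof -
  have "complex_of_real ((norm (c *s z))\<^sup>2) = of_real ((cmod c * norm z)\<^sup>2)"
    unfolding herm_self[symmetric] herm_simps
    by (simp add: herm_self power_mult_distrib complex_norm_square del: of_real_power)
  then have "(norm (c *s z))\<^sup>2 = (cmod c * norm z)\<^sup>2"
    using of_real_eq_iff by blast
  then show ?thesis by (simp add: power2_eq_iff_nonneg)
qed

text \<open>
  The inner product of the real Euclidean structure is the real part of \<open>herm\<close>, so a
  statement about \<open>|herm z w|\<close> follows from one about inner products once a unimodular factor has made
  the Hermitian product real and nonnegative.
\<close>

lemma exists_phase: "\<exists>e. cmod e = 1 \<and> cnj e * c = of_real (cmod c)"
proof (cases "c = 0")
  case False
  then have "cmod (sgn c) = 1" "cnj (sgn c) * c = of_real (cmod c)"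
    using complex_norm_square[of c]
    by (auto simp: norm_sgn sgn_eq[of c] norm_divide power2_eq_square divide_simps)
  then show ?thesis by blast
qed (auto intro: exI[of _ 1])

lemma cmod_herm_le: "cmod (herm z w) \<le> norm z * norm w"
proof -
  obtain e where e: "cmod e = 1" "cnj e * herm z w = of_real (cmod (herm z w))"
    using exists_phase by blast
  have "cmod (herm z w) = inner z (e *s w)"
    using e by (simp add: inner_eq_Re_herm herm_simps)
  also have "\<dots> \<le> norm z * norm w"
    using norm_cauchy_schwarz[of z "e *s w"] e by (simp add: norm_scale)
  finally show ?thesis .
qed

lemma one_minus_herm_nonzero:
  assumes "norm z \<le> 1" "norm a < 1"
  shows "1 - herm z a \<noteq> 0"
proof
  assume "1 - herm z a = 0"
  then have "cmod (herm z a) = 1" by simp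
  moreover have "norm z * norm a < 1"
    using assms mult_right_mono[of "norm z" 1 "norm a"] by simp
  ultimately show False using cmod_herm_le[of z a] by simp
qed

text \<open>
  The classical involution exchanging \<open>0\<close> and \<open>a\<close>: with \<open>s = sqrt (1 - |a|\<^sup>2)\<close> and \<open>P\<close>
  the orthogonal projection onto the line of \<open>a\<close>, it is
  \<open>(a - P z - s (z - P z)) / (1 - \<langle>z, a\<rangle>)\<close>. Because \<open>1 - s = |a|\<^sup>2 / (1 + s)\<close>, the numerator can be
  written without dividing by \<open>|a|\<^sup>2\<close>, and \<open>a = 0\<close> is not a special case.
\<close>

definition ball_involution :: "complex ^ 'n \<Rightarrow> complex ^ 'n \<Rightarrow> complex ^ 'n" where
  "ball_involution a z = inverse (1 - herm z a) *s
     ((1 - herm z a / of_real (1 + sqrt (1 - (norm a)\<^sup>2))) *s a - of_real (sqrt (1 - (norm a)\<^sup>2)) *s z)"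

text \<open>
  This identity is behind both uses of the involution: the right-hand side is positive inside the ball, so
  the ball is mapped into itself, and up to the symmetric factor on the right it expresses
  \<open>|1 - \<langle>z, a\<rangle>|\<close> through the norm of the image, which gives the invariant of pairs of points used
  below.
\<close>

lemma one_minus_norm_ball_involution:
  fixes a z :: "complex ^ 'n"
  assumes a: "norm a < 1" and z: "norm z \<le> 1"
  shows "(1 - (norm (ball_involution a z))\<^sup>2) * (cmod (1 - herm z a))\<^sup>2
       = (1 - (norm a)\<^sup>2) * (1 - (norm z)\<^sup>2)"
proof -
  define s where "s = sqrt (1 - (norm a)\<^sup>2)"
  define h where "h = herm z a"
  define n where "n = (1 - h / of_real (1 + s)) *s a - of_real s *s z"
  have "(norm a)\<^sup>2 < 1" using a by (simp add: power_less_one_iff abs_square_less_1)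
  then have s2: "s\<^sup>2 = 1 - (norm a)\<^sup>2" and s0: "0 < s" by (auto simp: s_def)
  have h1: "1 - h \<noteq> 0" using one_minus_herm_nonzero[OF z a] by (simp add: h_def)
  have m: "ball_involution a z = inverse (1 - h) *s n"
    by (simp add: ball_involution_def n_def s_def h_def)
  have az: "herm a z = cnj h" by (simp add: h_def cnj_herm)
  have s1: "1 + s \<noteq> 0" "1 + complex_of_real s \<noteq> 0"
    using s0 by (auto simp: complex_eq_iff)
  have "complex_of_real ((norm n)\<^sup>2 + (1 - (norm a)\<^sup>2) * (1 - (norm z)\<^sup>2)) = of_real ((cmod (1 - h))\<^sup>2)"
  proof -
    have na: "complex_of_real ((norm a)\<^sup>2) = 1 - (of_real s)\<^sup>2" using s2 by (simp flip: of_real_power)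
    then have aa: "herm a a = 1 - (of_real s)\<^sup>2" by (simp add: herm_self)
    have zz: "herm z z = of_real ((norm z)\<^sup>2)" by (rule herm_self)
    have "herm n n + (of_real s)\<^sup>2 * (1 - of_real ((norm z)\<^sup>2)) = (1 - h) * cnj (1 - h)"
      unfolding n_def herm_simps az h_def[symmetric] zz aa
      using s1 by (simp add: divide_simps) (simp add: algebra_simps power2_eq_square)
    then show ?thesis
      by (simp add: herm_self s2[symmetric] complex_norm_square del: of_real_power complex_cnj_diff)
        (metis of_real_power)
  qed
  then have *: "(norm n)\<^sup>2 + (1 - (norm a)\<^sup>2) * (1 - (norm z)\<^sup>2) = (cmod (1 - h))\<^sup>2"
    using of_real_eq_iff by blast
  have "(norm (ball_involution a z))\<^sup>2 * (cmod (1 - h))\<^sup>2 = (norm n)\<^sup>2"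
    using h1 by (simp add: m norm_scale norm_inverse power_mult_distrib power_inverse)
  then show ?thesis using * by (simp add: h_def algebra_simps)
qed

lemma norm_ball_involution_less_1:
  assumes a: "norm a < 1" and z: "norm z < 1"
  shows "norm (ball_involution a z) < 1"
proof -
  have "(norm a)\<^sup>2 < 1" "(norm z)\<^sup>2 < 1" using a z by (auto simp: abs_square_less_1)
  then have "0 < (1 - (norm (ball_involution a z))\<^sup>2) * (cmod (1 - herm z a))\<^sup>2"
    using one_minus_norm_ball_involution[of a z] a z by simp
  then have "0 < 1 - (norm (ball_involution a z))\<^sup>2" by (simp add: zero_less_mult_iff)
  then show ?thesis by (simp add: abs_square_less_1)
qed

lemma one_minus_herm_ball_involution:
  fixes a z :: "complex ^ 'n"
  assumes a: "norm a < 1" and z: "norm z \<le> 1"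
  shows "1 - herm (ball_involution a z) a = of_real (1 - (norm a)\<^sup>2) / (1 - herm z a)"
proof -
  define s where "s = sqrt (1 - (norm a)\<^sup>2)"
  define h where "h = herm z a"
  have "(norm a)\<^sup>2 < 1" using a by (simp add: abs_square_less_1)
  then have s2: "s\<^sup>2 = 1 - (norm a)\<^sup>2" and s0: "0 < s" by (auto simp: s_def)
  have na: "complex_of_real ((norm a)\<^sup>2) = 1 - (of_real s)\<^sup>2" using s2 by (simp flip: of_real_power)
  have h1: "1 - h \<noteq> 0" using one_minus_herm_nonzero[OF z a] by (simp add: h_def)
  have s1: "1 + complex_of_real s \<noteq> 0" using s0 by (auto simp: complex_eq_iff)
  have "(1 - h / of_real (1 + s)) * (1 - (of_real s)\<^sup>2) - of_real s * h = 1 - (of_real s)\<^sup>2 - h"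
    using s1 by (simp add: divide_simps) (simp add: algebra_simps power2_eq_square)
  then have "herm (ball_involution a z) a = inverse (1 - h) * (1 - (of_real s)\<^sup>2 - h)"
    unfolding ball_involution_def s_def[symmetric] herm_simps h_def[symmetric] herm_self na by simp
  then show ?thesis
    using h1 s2 by (simp add: h_def[symmetric] field_simps flip: of_real_power)
qed

lemma ball_involution_ball_involution:
  fixes a z :: "complex ^ 'n"
  assumes a: "norm a < 1" and z: "norm z \<le> 1"
  shows "ball_involution a (ball_involution a z) = z"
proof -
  define s where "s = sqrt (1 - (norm a)\<^sup>2)"
  define h where "h = herm z a"
  define g where "g = herm (ball_involution a z) a"
  have "(norm a)\<^sup>2 < 1" using a by (simp add: abs_square_less_1)
  then have s2: "s\<^sup>2 = 1 - (norm a)\<^sup>2" and s0: "0 < s" by (auto simp: s_def)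
  have h1: "1 - h \<noteq> 0" using one_minus_herm_nonzero[OF z a] by (simp add: h_def)
  have s1: "1 + complex_of_real s \<noteq> 0" "complex_of_real s \<noteq> 0" using s0 by (auto simp: complex_eq_iff)
  have "1 - g = (of_real s)\<^sup>2 / (1 - h)"
    using one_minus_herm_ball_involution[OF a z] s2 by (simp add: g_def h_def flip: of_real_power)
  then have g: "g = 1 - (of_real s)\<^sup>2 / (1 - h)" by (simp add: algebra_simps)
  show ?thesis
  proof (rule vec_eq_iff[THEN iffD2], rule allI)
    fix i
    have m: "ball_involution a z $ i = inverse (1 - h) * ((1 - h / of_real (1 + s)) * a $ i - of_real s * z $ i)"
      by (simp add: ball_involution_def s_def h_def algebra_simps)
    have "ball_involution a (ball_involution a z) $ i
        = inverse (1 - g) * ((1 - g / of_real (1 + s)) * a $ i - of_real s * ball_involution a z $ i)"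
      by (simp add: ball_involution_def[of a "ball_involution a z"] s_def g_def algebra_simps)
    also have "\<dots> = z $ i"
    proof -
      define d where "d = 1 - h"
      have h: "h = 1 - d" and d: "d \<noteq> 0" using h1 by (auto simp: d_def)
      have "1 - g = (of_real s)\<^sup>2 / d" by (simp add: g d_def)
      then have ig: "inverse (1 - g) = d / (of_real s)\<^sup>2" by simp
      have g': "g = 1 - (of_real s)\<^sup>2 / d" by (simp add: g d_def)
      show ?thesis
        unfolding m ig unfolding g' h of_real_add of_real_1 using d s1
        by (simp add: divide_simps) (simp add: algebra_simps power2_eq_square)
    qed
    finally show "ball_involution a (ball_involution a z) $ i = z $ i" .
  qed
qed

lemma ball_involution_0 [simp]: "ball_involution a 0 = a"
  by (simp add: ball_involution_def)

lemma ball_involution_self: "norm a < 1 \<Longrightarrow> ball_involution a a = 0"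
  using ball_involution_ball_involution[of a 0] by simp

section \<open>Automorphisms of the ball\<close>

lemma bounded_bilinear_vector_scalar_mult:
  "bounded_bilinear (\<lambda>c (z :: complex ^ 'n). c *s z)"
proof
  show "\<exists>K. \<forall>a (b :: complex ^ 'n). norm (a *s b) \<le> norm a * norm b * K"
    by (intro exI[of _ 1]) (simp add: norm_scale)
qed (vector algebra_simps scaleR_conv_of_real)+

lemmas bounded_linear_scale_left = bounded_bilinear.bounded_linear_left[OF bounded_bilinear_vector_scalar_mult]
lemmas bounded_linear_scale_right = bounded_bilinear.bounded_linear_right[OF bounded_bilinear_vector_scalar_mult]

lemma scaleR_eq_scale: "r *\<^sub>R (z :: complex ^ 'n) = of_real r *s z"
  by (vector scaleR_conv_of_real)

lemma bounded_linear_herm_left: "bounded_linear (\<lambda>z. herm z w)"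
  by (rule bounded_linear_intro[where K = "norm w"])
    (simp_all add: herm_simps scaleR_eq_scale scaleR_conv_of_real cmod_herm_le)

lemma holomorphic_map_onD:
  fixes f :: "complex ^ 'n \<Rightarrow> complex ^ 'm"
  assumes "holomorphic_map_on f unit_ball" "norm z < 1"
  obtains D where "(f has_derivative D) (at z)" "Vector_Spaces.linear (*s) (*s) D"
proof -
  have z: "z \<in> unit_ball" using assms(2) by simp
  then have "at z within unit_ball = at z" by (rule at_within_open) simp
  with assms(1) z show thesis using that unfolding holomorphic_map_on_def by metis
qed

lemma holomorphic_map_onI:
  fixes f :: "complex ^ 'n \<Rightarrow> complex ^ 'm"
  assumes "\<And>z. norm z < 1 \<Longrightarrow> \<exists>D. (f has_derivative D) (at z) \<and> Vector_Spaces.linear (*s) (*s) D"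
  shows "holomorphic_map_on f unit_ball"
  using assms unfolding holomorphic_map_on_def
  by (metis has_derivative_at_withinI mem_ball_0)

lemma complex_linearI:
  fixes D :: "complex ^ 'n \<Rightarrow> complex ^ 'm"
  assumes "\<And>x y. D (x + y) = D x + D y" "\<And>c x. D (c *s x) = c *s D x"
  shows "Vector_Spaces.linear (*s) (*s) D"
  using assms by (simp add: Vector_Spaces.linear_iff vec.vector_space_axioms)

lemma complex_linearD:
  assumes "Vector_Spaces.linear (*s) (*s) D"
  shows "D (x + y) = D x + D y" "D (c *s x) = c *s D x"
  using assms by (simp_all add: Vector_Spaces.linear_iff)

lemma holomorphic_map_on_compose:
  fixes f :: "complex ^ 'n \<Rightarrow> complex ^ 'm" and g :: "complex ^ 'm \<Rightarrow> complex ^ 'k"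
  assumes f: "holomorphic_map_on f unit_ball" and g: "holomorphic_map_on g unit_ball"
    and sub: "\<And>z. norm z < 1 \<Longrightarrow> norm (f z) < 1"
  shows "holomorphic_map_on (\<lambda>z. g (f z)) unit_ball"
proof (rule holomorphic_map_onI)
  fix z :: "complex ^ 'n" assume z: "norm z < 1"
  obtain D where D: "(f has_derivative D) (at z)" "Vector_Spaces.linear (*s) (*s) D"
    using holomorphic_map_onD[OF f z] .
  obtain E where E: "(g has_derivative E) (at (f z))" "Vector_Spaces.linear (*s) (*s) E"
    using holomorphic_map_onD[OF g sub[OF z]] .
  have "((\<lambda>z. g (f z)) has_derivative (\<lambda>x. E (D x))) (at z)"
    by (rule has_derivative_compose[OF D(1) E(1)])
  moreover have "Vector_Spaces.linear (*s) (*s) (\<lambda>x. E (D x))"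
    by (rule complex_linearI) (simp_all only: complex_linearD[OF D(2)] complex_linearD[OF E(2)])
  ultimately show "\<exists>D. ((\<lambda>z. g (f z)) has_derivative D) (at z) \<and> Vector_Spaces.linear (*s) (*s) D"
    by blast
qed

lemma holomorphic_map_on_cong:
  fixes f :: "complex ^ 'n \<Rightarrow> complex ^ 'm"
  assumes f: "holomorphic_map_on f unit_ball" and eq: "\<And>z. norm z < 1 \<Longrightarrow> f z = g z"
  shows "holomorphic_map_on g unit_ball"
  unfolding holomorphic_map_on_def
proof
  fix z :: "complex ^ 'n" assume z: "z \<in> unit_ball"
  then obtain D where "(f has_derivative D) (at z within unit_ball)" "Vector_Spaces.linear (*s) (*s) D"
    using f unfolding holomorphic_map_on_def by meson
  moreover from this(1) have "(g has_derivative D) (at z within unit_ball)"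
    by (rule has_derivative_transform[OF z, rotated]) (simp add: eq)
  ultimately show "\<exists>D. (g has_derivative D) (at z within unit_ball) \<and> Vector_Spaces.linear (*s) (*s) D"
    by blast
qed

lemma holomorphic_map_on_ball_involution:
  fixes a :: "complex ^ 'n"
  assumes a: "norm a < 1"
  shows "holomorphic_map_on (ball_involution a) unit_ball"
proof (rule holomorphic_map_onI)
  fix z :: "complex ^ 'n" assume z: "norm z < 1"
  define s where "s = complex_of_real (sqrt (1 - (norm a)\<^sup>2))"
  define r where "r = 1 + s"
  have nz: "1 - herm z a \<noteq> 0" using one_minus_herm_nonzero[of z a] a z by simp
  have m: "ball_involution a = (\<lambda>z. inverse (1 - herm z a) *s ((1 - herm z a / r) *s a - s *s z))"
    by (rule ext) (simp add: ball_involution_def s_def r_def)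
  note [derivative_intros] = bounded_linear.has_derivative[OF bounded_linear_herm_left]
    bounded_linear.has_derivative[OF bounded_linear_scale_right]
    bounded_bilinear.FDERIV[OF bounded_bilinear_vector_scalar_mult]
  define k where "k = inverse (1 - herm z a)"
  define w where "w = (1 - herm z a / r) *s a - s *s z"
  define D where "D = (\<lambda>x. k *s ((- (herm x a / r)) *s a - s *s x) + (k * herm x a * k) *s w)"
  have "(ball_involution a has_derivative D) (at z)"
    unfolding m D_def k_def w_def using nz by (auto intro!: derivative_eq_intros ext simp: divide_inverse)
  moreover have "Vector_Spaces.linear (*s) (*s) D"
    by (rule complex_linearI)
      (simp_all add: D_def vec_eq_iff herm_simps add_divide_distrib algebra_simps)
  ultimately show "\<exists>D. (ball_involution a has_derivative D) (at z) \<and> Vector_Spaces.linear (*s) (*s) D"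
    by blast
qed

text \<open>
  The inverse is carried along explicitly and nothing is required off the ball, so that composites need no
  restriction and the involutions qualify as they stand.
\<close>

definition bihol :: "(complex ^ 'n \<Rightarrow> complex ^ 'n) \<Rightarrow> (complex ^ 'n \<Rightarrow> complex ^ 'n) \<Rightarrow> bool" where
  "bihol g h \<longleftrightarrow> (\<forall>z. norm z < 1 \<longrightarrow> norm (g z) < 1 \<and> norm (h z) < 1 \<and> h (g z) = z \<and> g (h z) = z) \<and>
    holomorphic_map_on g unit_ball \<and> holomorphic_map_on h unit_ball"

lemma bihol_sym: "bihol g h \<Longrightarrow> bihol h g"
  by (auto simp: bihol_def)

lemma bihol_ball_involution: "norm a < 1 \<Longrightarrow> bihol (ball_involution a) (ball_involution a)"
  by (simp add: bihol_def norm_ball_involution_less_1 ball_involution_ball_involution holomorphic_map_on_ball_involution)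

lemma bihol_compose: "bihol g h \<Longrightarrow> bihol g' h' \<Longrightarrow> bihol (\<lambda>z. g' (g z)) (\<lambda>z. h (h' z))"
  by (auto simp: bihol_def intro: holomorphic_map_on_compose)

lemma ball_aut_iff: "g \<in> ball_aut \<longleftrightarrow> g \<in> extensional unit_ball \<and> (\<exists>h. bihol g h)"
proof safe
  assume g: "g \<in> ball_aut"
  then have bij: "bij_betw g unit_ball unit_ball"
    and hol: "holomorphic_map_on g unit_ball" "holomorphic_map_on (the_inv_into unit_ball g) unit_ball"
    by (auto simp: ball_aut_def)
  show "g \<in> extensional unit_ball" using g by (simp add: ball_aut_def)
  have "bij_betw (the_inv_into unit_ball g) unit_ball unit_ball"
    by (rule bij_betw_the_inv_into[OF bij])
  then have "norm (g z) < 1 \<and> norm (the_inv_into unit_ball g z) < 1 \<and>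
      the_inv_into unit_ball g (g z) = z \<and> g (the_inv_into unit_ball g z) = z" if "norm z < 1" for z
    using that bij the_inv_into_f_f[of g unit_ball z] f_the_inv_into_f[of g unit_ball z]
    by (force simp: bij_betw_def)
  then show "\<exists>h. bihol g h" using hol by (auto simp: bihol_def)
next
  fix h assume ext: "g \<in> extensional unit_ball" and b: "bihol g h"
  have bij: "bij_betw g unit_ball unit_ball"
    by (rule bij_betw_byWitness[where f' = h]) (use b in \<open>auto simp: bihol_def\<close>)
  have "h z = the_inv_into unit_ball g z" if "norm z < 1" for z
    using that b bij the_inv_into_f_f[of g unit_ball "h z"] by (auto simp: bihol_def bij_betw_def)
  then show "g \<in> ball_aut"
    using ext bij b holomorphic_map_on_cong[of h "the_inv_into unit_ball g"]
    by (auto simp: ball_aut_def bihol_def)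
qed

lemma bihol_restrict:
  fixes g :: "complex ^ 'n \<Rightarrow> complex ^ 'n"
  assumes "bihol g h"
  shows "restrict g unit_ball \<in> ball_aut"
proof -
  have "bihol (restrict g unit_ball) h"
    using assms holomorphic_map_on_cong[of g "restrict g unit_ball"] by (auto simp: bihol_def)
  then show ?thesis by (auto simp: ball_aut_iff)
qed

lemma has_field_derivative_along_line:
  fixes g :: "complex ^ 'n \<Rightarrow> complex ^ 'm"
  assumes "(g has_derivative D) (at (\<zeta> *s v))" "Vector_Spaces.linear (*s) (*s) D"
  shows "((\<lambda>t. herm (g (t *s v)) w) has_field_derivative herm (D v) w) (at \<zeta>)"
proof -
  have "((\<lambda>t. g (t *s v)) has_derivative (\<lambda>t. D (t *s v))) (at \<zeta>)"
    using has_derivative_compose[OF bounded_linear.has_derivative[OF bounded_linear_scale_left has_derivative_ident]]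
      assms(1) by blast
  then have "((\<lambda>t. herm (g (t *s v)) w) has_derivative (\<lambda>t. herm (D (t *s v)) w)) (at \<zeta>)"
    by (rule bounded_linear.has_derivative[OF bounded_linear_herm_left])
  then show ?thesis
    using complex_linearD[OF assms(2)]
    by (simp add: has_field_derivative_def herm_simps mult_commute_abs)
qed

lemma holomorphic_on_line:
  fixes g :: "complex ^ 'n \<Rightarrow> complex ^ 'm"
  assumes "holomorphic_map_on g unit_ball"
  shows "(\<lambda>t. herm (g (t *s v)) w) holomorphic_on {t. norm (t *s v) < 1}"
proof -
  have "(\<lambda>t. herm (g (t *s v)) w) field_differentiable (at \<zeta>)" if "norm (\<zeta> *s v) < 1" for \<zeta>
    using holomorphic_map_onD[OF assms that] has_field_derivative_along_line
    unfolding field_differentiable_def by metis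
  then show ?thesis
    by (auto simp: holomorphic_on_def intro: field_differentiable_at_within)
qed

text \<open>
  Pairing a self-map of the ball with a unit vector along a disc through the origin gives a self-map of the
  unit disc, to which the one-dimensional Schwarz lemma applies.
\<close>

lemma Schwarz_slice:
  fixes g :: "complex ^ 'n \<Rightarrow> complex ^ 'n"
  assumes hol: "holomorphic_map_on g unit_ball" and maps: "\<And>z. norm z < 1 \<Longrightarrow> norm (g z) < 1"
    and "g 0 = 0" and u: "norm u = 1" and w: "norm w = 1"
  shows "(\<lambda>t. herm (g (t *s u)) w) holomorphic_on (ball 0 1)"
    and "cmod t < 1 \<Longrightarrow> cmod (herm (g (t *s u)) w) < 1"
proof -
  have *: "{t. norm (t *s u) < 1} = ball 0 1" using u by (auto simp: norm_scale)
  show "(\<lambda>t. herm (g (t *s u)) w) holomorphic_on (ball 0 1)"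
    using holomorphic_on_line[OF hol, of u w] unfolding * .
  show "cmod (herm (g (t *s u)) w) < 1" if "cmod t < 1"
    using cmod_herm_le[of "g (t *s u)" w] maps[of "t *s u"] u w that by (simp add: norm_scale)
qed

lemma Schwarz_ball:
  fixes g :: "complex ^ 'n \<Rightarrow> complex ^ 'n"
  assumes hol: "holomorphic_map_on g unit_ball" and maps: "\<And>z. norm z < 1 \<Longrightarrow> norm (g z) < 1"
    and g0: "g 0 = 0" and z: "norm z < 1"
  shows "norm (g z) \<le> norm z"
proof (cases "z = 0 \<or> g z = 0")
  case False
  define u where "u = inverse (of_real (norm z)) *s z"
  define w where "w = inverse (of_real (norm (g z))) *s g z"
  have u: "norm u = 1" and w: "norm w = 1" using False by (auto simp: u_def w_def norm_scale norm_inverse)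
  have zu: "z = of_real (norm z) *s u" using False by (simp add: u_def vec_eq_iff)
  have gz: "herm (g z) w = of_real (norm (g z))"
    using False by (simp add: w_def herm_simps herm_self power2_eq_square)
  have "cmod (herm (g (of_real (norm z) *s u)) w) \<le> cmod (of_real (norm z))"
    by (rule Schwarz_Lemma(1)[OF Schwarz_slice(1)[OF hol maps g0 u w]])
      (use Schwarz_slice(2)[OF hol maps g0 u w] g0 z in auto)
  then show ?thesis using gz zu by simp
qed (auto simp: g0)

text \<open>
  The equality case of the Cauchy-Schwarz inequality, in the form in which it turns extremality in the
  one-dimensional Schwarz lemma into a statement about vectors.
\<close>

lemma eq_if_norm_le_herm:
  assumes "norm (x :: complex ^ 'n) \<le> cmod c" "norm w = 1" "herm x w = c"
  shows "x = c *s w"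
proof -
  have "herm (x - c *s w) (x - c *s w)
      = herm x x - cnj c * herm x w - c * herm w x + c * cnj c * herm w w"
    by (simp add: herm_simps algebra_simps)
  also have "\<dots> = of_real ((norm x)\<^sup>2) - c * cnj c"
    using assms(3) cnj_herm[of x w] by (simp add: herm_self assms(2))
  also have "\<dots> = of_real ((norm x)\<^sup>2 - (cmod c)\<^sup>2)"
    unfolding of_real_diff complex_norm_square ..
  finally have "(norm (x - c *s w))\<^sup>2 = (norm x)\<^sup>2 - (cmod c)\<^sup>2"
    unfolding herm_self using of_real_eq_iff by blast
  moreover have "(norm x)\<^sup>2 \<le> (cmod c)\<^sup>2" using assms(1) by (simp add: power_mono)
  ultimately have "(norm (x - c *s w))\<^sup>2 \<le> 0" by simp
  then show ?thesis by simp
qed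

text \<open>
  Cartan's theorem for the ball. The Schwarz lemma for the map and for its inverse shows that norms are
  preserved. Hence on every complex line through \<open>0\<close> a suitable one-dimensional slice is extremal for the
  Schwarz lemma, which makes the map homogeneous on that line; a map that is homogeneous on all these lines
  agrees with its derivative at \<open>0\<close>.
\<close>

lemma bihol_fixing_0_unitary:
  fixes g :: "complex ^ 'n \<Rightarrow> complex ^ 'n"
  assumes b: "bihol g h" and g0: "g 0 = 0"
  obtains A :: "complex ^ 'n ^ 'n"
  where "\<And>z. norm z < 1 \<Longrightarrow> g z = A *v z" "\<And>x. norm (A *v x) = norm x"
proof -
  have h0: "h 0 = 0" using b g0 unfolding bihol_def by (metis norm_zero zero_less_one)
  have hol: "holomorphic_map_on g unit_ball" and maps: "\<And>z. norm z < 1 \<Longrightarrow> norm (g z) < 1"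
    and holh: "holomorphic_map_on h unit_ball" and mapsh: "\<And>z. norm z < 1 \<Longrightarrow> norm (h z) < 1"
    and hg: "\<And>z. norm z < 1 \<Longrightarrow> h (g z) = z"
    using b by (auto simp: bihol_def)
  have norm_g: "norm (g z) = norm z" if "norm z < 1" for z
    using Schwarz_ball[OF hol maps g0 that] Schwarz_ball[OF holh mapsh h0 maps[OF that]] hg[OF that]
    by simp
  obtain D where D: "(g has_derivative D) (at 0)" and linD: "Vector_Spaces.linear (*s) (*s) D"
    using holomorphic_map_onD[OF hol, of 0] by auto
  have on_line: "g (t *s u) = t *s D u" if u: "norm u = 1" and t: "cmod t < 1" for t u
  proof -
    have half: "norm (g ((1/2) *s u)) = 1/2"
      using norm_g[of "(1/2) *s u"] u by (simp add: norm_scale)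
    define w where "w = (2 :: complex) *s g ((1/2) *s u)"
    have w: "norm w = 1" using half by (simp add: w_def norm_scale)
    have "herm (g ((1/2) *s u)) w = 1/2"
      unfolding w_def herm_simps herm_self half by (simp add: power2_eq_square)
    then have "\<exists>z. norm z < 1 \<and> z \<noteq> 0 \<and> cmod (herm (g (z *s u)) w) = norm z"
      by (intro exI[of _ "1/2"] conjI) (simp_all only: norm_divide, simp_all)
    then obtain \<alpha> where \<alpha>: "\<And>z. cmod z < 1 \<Longrightarrow> herm (g (z *s u)) w = \<alpha> * z" "cmod \<alpha> = 1"
      using Schwarz_Lemma(3)[OF Schwarz_slice(1)[OF hol maps g0 u w], of 0]
        Schwarz_slice(2)[OF hol maps g0 u w] g0 by auto
    have line: "g (z *s u) = (\<alpha> * z) *s w" if "cmod z < 1" for z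
    proof (rule eq_if_norm_le_herm[OF _ w])
      show "norm (g (z *s u)) \<le> cmod (\<alpha> * z)"
        using norm_g[of "z *s u"] that u \<alpha> by (simp add: norm_scale norm_mult)
    qed (use \<alpha> that in auto)
    have "((\<lambda>z. g (z *s u)) has_derivative (\<lambda>z. D (z *s u))) (at 0)"
      using has_derivative_compose[OF bounded_linear.has_derivative[OF
            bounded_linear_scale_left[of u] has_derivative_ident], of g D 0 UNIV] D by simp
    moreover have "((\<lambda>z. g (z *s u)) has_derivative (\<lambda>z. (\<alpha> * z) *s w)) (at 0)"
    proof (rule has_derivative_transform_within_open[of _ _ _ _ "ball 0 1"])
      show "((\<lambda>z. (\<alpha> * z) *s w) has_derivative (\<lambda>z. (\<alpha> * z) *s w)) (at 0)"
        by (intro bounded_linear.has_derivative[OF bounded_linear_scale_left] derivative_eq_intros) auto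
    qed (auto simp: line)
    ultimately have "(\<lambda>z. D (z *s u)) = (\<lambda>z. (\<alpha> * z) *s w)"
      by (rule has_derivative_unique)
    then show ?thesis using line[OF t] complex_linearD[OF linD] by (metis)
  qed
  have Dg: "g z = D z" if "norm z < 1" for z
  proof (cases "z = 0")
    case True
    then show ?thesis using g0 complex_linearD(2)[OF linD, of 0 0] by simp
  next
    case False
    define u where "u = inverse (of_real (norm z)) *s z"
    have "norm u = 1" "z = of_real (norm z) *s u"
      using False by (auto simp: u_def norm_scale norm_inverse vec_eq_iff)
    then show ?thesis
      using on_line[of u "of_real (norm z)"] that complex_linearD[OF linD] by (metis norm_of_real abs_norm_cancel)
  qed
  show thesis
  proof (rule that)
    have A: "matrix D *v x = D x" for x using matrix_works[OF linD] .
    show "g z = matrix D *v z" if "norm z < 1" for z using Dg[OF that] A by simp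
    show "norm (matrix D *v x) = norm x" for x
    proof -
      define r where "r = inverse (2 * (norm x + 1))"
      have r: "0 < r" by (simp add: r_def add_nonneg_pos)
      have small: "norm (of_real r *s x) < 1"
        using r by (simp add: norm_scale) (simp add: r_def field_simps add_nonneg_pos)
      then have "norm (D (of_real r *s x)) = norm (of_real r *s x)"
        using norm_g[OF small] Dg[OF small] by simp
      then have "norm (of_real r *s D x) = norm (of_real r *s x)"
        unfolding complex_linearD(2)[OF linD] .
      then show ?thesis using r by (simp add: A norm_scale)
    qed
  qed
qed

section \<open>A fixed point of a group with a bounded orbit\<close>

text \<open>
  Both sides say that \<open>|1 - \<langle>z, w\<rangle>|\<^sup>2 / ((1 - |z|\<^sup>2) (1 - |w|\<^sup>2))\<close>, which is \<open>cosh\<^sup>2\<close> of the hyperbolic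
  distance, is invariant under automorphisms; denominators are cleared. Conjugating by the involutions at
  \<open>w\<close> and at \<open>g w\<close> reduces this to automorphisms fixing \<open>0\<close>, which preserve the norm.
\<close>

lemma bihol_herm_invariant:
  assumes b: "bihol g h" and z: "norm z < 1" and w: "norm w < 1"
  shows "(cmod (1 - herm (g z) (g w)))\<^sup>2 * ((1 - (norm z)\<^sup>2) * (1 - (norm w)\<^sup>2))
       = (cmod (1 - herm z w))\<^sup>2 * ((1 - (norm (g z))\<^sup>2) * (1 - (norm (g w))\<^sup>2))"
proof -
  have gz: "norm (g z) < 1" and gw: "norm (g w) < 1" using b z w by (auto simp: bihol_def)
  have T: "bihol (\<lambda>x. ball_involution (g w) (g (ball_involution w x))) (\<lambda>x. ball_involution w (h (ball_involution (g w) x)))"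
    using bihol_compose[OF bihol_compose[OF bihol_ball_involution[OF w] b] bihol_ball_involution[OF gw]] .
  obtain A where A: "\<And>x. norm x < 1 \<Longrightarrow> ball_involution (g w) (g (ball_involution w x)) = A *v x" "\<And>x. norm (A *v x) = norm x"
    using bihol_fixing_0_unitary[OF T] ball_involution_self[OF gw] by auto
  have *: "norm (ball_involution (g w) (g z)) = norm (ball_involution w z)"
    using A(1)[OF norm_ball_involution_less_1[OF w z]] A(2) ball_involution_ball_involution[OF w, of z] z by simp
  have swap: "Q' * (x * y) = Q * (x' * y')" if "M * Q = y * x" "M * Q' = y' * x'" for M Q Q' x y x' y' :: real
  proof -
    have "Q' * (x * y) = Q' * (M * Q)" using that(1) by (simp only: mult.commute)
    also have "\<dots> = Q * (M * Q')" by (simp only: mult_ac)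
    also have "\<dots> = Q * (x' * y')" using that(2) by (simp only: mult.commute)
    finally show ?thesis .
  qed
  show ?thesis
    by (rule swap[OF one_minus_norm_ball_involution[OF w less_imp_le[OF z]]
          one_minus_norm_ball_involution[OF gw less_imp_le[OF gz], unfolded *]])
qed

lemma reversed_Cauchy_Schwarz:
  assumes z: "norm z < 1" and w: "norm w < 1" and "z \<noteq> w"
  shows "(1 - (norm z)\<^sup>2) * (1 - (norm w)\<^sup>2) < (cmod (1 - herm z w))\<^sup>2"
proof -
  have "ball_involution w z \<noteq> 0"
    using ball_involution_ball_involution[OF w, of z] z \<open>z \<noteq> w\<close> by auto
  moreover have "0 < (cmod (1 - herm z w))\<^sup>2"
    using one_minus_herm_nonzero[of z w] z w by simp
  ultimately have "(1 - (norm (ball_involution w z))\<^sup>2) * (cmod (1 - herm z w))\<^sup>2 < 1 * (cmod (1 - herm z w))\<^sup>2"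
    by (intro mult_strict_right_mono) auto
  then show ?thesis
    using one_minus_norm_ball_involution[OF w, of z] z by (simp add: mult.commute)
qed

text \<open>
  Strict convexity of hyperbolic balls: if \<open>S\<close> lies in a ball of the same radius about \<open>p\<close> and about
  \<open>q\<close>, it lies in a strictly smaller ball about the midpoint of \<open>p\<close> and \<open>q\<close>. In the hyperboloid
  model this is the triangle inequality. The points \<open>p, q\<close> lift to vectors \<open>P = (1, p) / sp\<close> and
  \<open>Q = e (1, q) / sq\<close> of square \<open>1\<close> for the form \<open>x\<^sub>0 cnj y\<^sub>0 - \<langle>x, y\<rangle>\<close>, with the phase \<open>e\<close> chosen
  so that their product is a real number \<open>|c|\<close>. The product of \<open>P + Q\<close> with a lift of \<open>z\<close> is at most
  twice the bound for \<open>P\<close> and \<open>Q\<close>, while the square of \<open>P + Q\<close> is \<open>2 + 2 |c|\<close>, which exceeds \<open>4\<close>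
  by the reversed Cauchy-Schwarz inequality.
\<close>

lemma hyperbolic_midpoint:
  fixes p q :: "complex ^ 'n"
  assumes p: "norm p < 1" and q: "norm q < 1" and "p \<noteq> q" and "0 < m"
    and pm: "\<And>z. z \<in> S \<Longrightarrow> (cmod (1 - herm p z))\<^sup>2 \<le> m * ((1 - (norm p)\<^sup>2) * (1 - (norm z)\<^sup>2))"
    and qm: "\<And>z. z \<in> S \<Longrightarrow> (cmod (1 - herm q z))\<^sup>2 \<le> m * ((1 - (norm q)\<^sup>2) * (1 - (norm z)\<^sup>2))"
  shows "\<exists>w t. norm w < 1 \<and> t < m \<and>
    (\<forall>z\<in>S. (cmod (1 - herm w z))\<^sup>2 \<le> t * ((1 - (norm w)\<^sup>2) * (1 - (norm z)\<^sup>2)))"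
proof -
  define sp where "sp = sqrt (1 - (norm p)\<^sup>2)"
  define sq where "sq = sqrt (1 - (norm q)\<^sup>2)"
  have "(norm p)\<^sup>2 < 1" "(norm q)\<^sup>2 < 1" using p q by (auto simp: abs_square_less_1)
  then have sp: "sp\<^sup>2 = 1 - (norm p)\<^sup>2" "0 < sp" and sq: "sq\<^sup>2 = 1 - (norm q)\<^sup>2" "0 < sq"
    by (auto simp: sp_def sq_def)
  define c where "c = (1 - herm p q) / of_real (sp * sq)"
  obtain e where e: "cmod e = 1" "cnj e * c = of_real (cmod c)" using exists_phase by blast
  have c1: "1 < cmod c"
  proof -
    have "(sp * sq)\<^sup>2 < (cmod (1 - herm p q))\<^sup>2"
      using reversed_Cauchy_Schwarz[OF p q \<open>p \<noteq> q\<close>] by (simp add: power_mult_distrib sp sq)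
    then have "sp * sq < cmod (1 - herm p q)" by (rule power_less_imp_less_base) simp
    then show ?thesis using sp sq by (simp add: c_def norm_divide norm_mult)
  qed
  define \<alpha> where "\<alpha> = inverse (complex_of_real sp)"
  define \<beta> where "\<beta> = e / of_real sq"
  define u where "u = \<alpha> + \<beta>"
  define v where "v = \<alpha> *s p + \<beta> *s q"
  have n\<alpha>: "cmod \<alpha> = inverse sp" and n\<beta>: "cmod \<beta> = inverse sq"
    using sp sq e by (auto simp: \<alpha>_def \<beta>_def norm_inverse norm_divide field_simps)
  have cross: "\<alpha> * cnj \<beta> * (1 - herm p q) = of_real (cmod c)"
    using e(2) sp sq by (simp add: \<alpha>_def \<beta>_def c_def field_simps)
  have cross': "cnj \<alpha> * \<beta> * (1 - herm q p) = of_real (cmod c)"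
    using arg_cong[OF cross, of cnj]
    by (simp only: complex_cnj_mult complex_cnj_diff complex_cnj_cnj complex_cnj_one
        complex_cnj_complex_of_real cnj_herm)
  have "complex_of_real ((cmod u)\<^sup>2 - (norm v)\<^sup>2) = u * cnj u - herm v v"
    by (simp add: herm_self complex_norm_square del: of_real_power)
  also have "\<dots> = \<alpha> * cnj \<alpha> * (1 - herm p p) + \<beta> * cnj \<beta> * (1 - herm q q)
      + \<alpha> * cnj \<beta> * (1 - herm p q) + cnj \<alpha> * \<beta> * (1 - herm q p)"
    by (simp add: u_def v_def herm_simps algebra_simps)
  also have "\<dots> = of_real ((cmod \<alpha>)\<^sup>2 * (1 - (norm p)\<^sup>2) + (cmod \<beta>)\<^sup>2 * (1 - (norm q)\<^sup>2) + 2 * cmod c)"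
    unfolding cross cross' by (simp add: herm_self complex_norm_square[symmetric] del: of_real_power)
  also have "(cmod \<alpha>)\<^sup>2 * (1 - (norm p)\<^sup>2) = 1"
    using sp(2) by (simp add: n\<alpha> sp(1)[symmetric] power_inverse)
  also have "(cmod \<beta>)\<^sup>2 * (1 - (norm q)\<^sup>2) = 1"
    using sq(2) by (simp add: n\<beta> sq(1)[symmetric] power_inverse)
  finally have uv: "(cmod u)\<^sup>2 - (norm v)\<^sup>2 = 2 + 2 * cmod c"
    using of_real_eq_iff[of "(cmod u)\<^sup>2 - (norm v)\<^sup>2" "2 + 2 * cmod c", where 'a=complex] by simp
  have "(norm v)\<^sup>2 < (cmod u)\<^sup>2" using uv c1 by linarith
  then have vu: "norm v < cmod u" by (rule power_less_imp_less_base) simp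
  then have u0: "u \<noteq> 0" using norm_ge_zero[of v] by auto
  define w where "w = inverse u *s v"
  have nw: "norm w = norm v / cmod u" by (simp add: w_def norm_scale norm_inverse divide_inverse)
  have w1: "norm w < 1" using vu u0 by (simp add: nw)
  have w2: "(1 - (norm w)\<^sup>2) * (cmod u)\<^sup>2 = 2 + 2 * cmod c"
    using u0 by (simp add: nw power_divide left_diff_distrib uv)
  define t where "t = 2 * m / (1 + cmod c)"
  have "t < m" using \<open>0 < m\<close> c1 by (simp add: t_def field_simps)
  moreover have "(cmod (1 - herm w z))\<^sup>2 \<le> t * ((1 - (norm w)\<^sup>2) * (1 - (norm z)\<^sup>2))" if z: "z \<in> S" for z
  proof -
    define y where "y = 1 - (norm z)\<^sup>2"
    have pz: "(cmod (1 - herm p z))\<^sup>2 \<le> m * y * sp\<^sup>2" and qz: "(cmod (1 - herm q z))\<^sup>2 \<le> m * y * sq\<^sup>2"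
      using pm[OF z] qm[OF z] by (simp_all add: y_def sp sq mult_ac)
    then have "0 \<le> m * y"
      using sp(2) by (meson order_trans zero_le_power2 zero_le_mult_iff zero_less_power not_less)
    have "cmod (\<alpha> * (1 - herm p z)) \<le> sqrt (m * y)"
      unfolding norm_mult n\<alpha> using real_le_rsqrt[OF pz] sp(2)
      by (simp add: real_sqrt_mult[of _ "sp\<^sup>2"] inverse_eq_divide pos_divide_le_eq)
    moreover have "cmod (\<beta> * (1 - herm q z)) \<le> sqrt (m * y)"
      unfolding norm_mult n\<beta> using real_le_rsqrt[OF qz] sq(2)
      by (simp add: real_sqrt_mult[of _ "sq\<^sup>2"] inverse_eq_divide pos_divide_le_eq)
    moreover have "u * (1 - herm w z) = \<alpha> * (1 - herm p z) + \<beta> * (1 - herm q z)"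
    proof -
      have "u * herm w z = herm v z" using u0 by (simp add: w_def herm_scale_left)
      then have "u * (1 - herm w z) = u - herm v z" by (simp add: right_diff_distrib)
      also have "\<dots> = \<alpha> * (1 - herm p z) + \<beta> * (1 - herm q z)"
        by (simp add: u_def v_def herm_simps algebra_simps)
      finally show ?thesis .
    qed
    ultimately have "cmod (u * (1 - herm w z)) \<le> 2 * sqrt (m * y)"
      using norm_triangle_ineq[of "\<alpha> * (1 - herm p z)" "\<beta> * (1 - herm q z)"] by simp
    then have "(cmod (u * (1 - herm w z)))\<^sup>2 \<le> (2 * sqrt (m * y))\<^sup>2"
      by (rule power_mono) simp
    also have "\<dots> = 4 * (m * y)" using \<open>0 \<le> m * y\<close> by (simp add: power_mult_distrib)
    also have "\<dots> = t * y * (2 + 2 * cmod c)"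
      using c1 by (simp add: t_def field_simps)
    also have "\<dots> = t * ((1 - (norm w)\<^sup>2) * y) * (cmod u)\<^sup>2"
      unfolding w2[symmetric] by (simp add: mult_ac)
    finally have "(cmod (1 - herm w z))\<^sup>2 * (cmod u)\<^sup>2 \<le> t * ((1 - (norm w)\<^sup>2) * y) * (cmod u)\<^sup>2"
      by (simp add: norm_mult power_mult_distrib mult_ac)
    then show ?thesis using u0 by (simp add: y_def)
  qed
  ultimately show ?thesis using w1 by blast
qed

lemma continuous_on_herm_left [continuous_intros]:
  "continuous_on S f \<Longrightarrow> continuous_on S (\<lambda>x. herm (f x) z)"
  by (rule bounded_linear.continuous_on[OF bounded_linear_herm_left])

text \<open>
  The centre of the smallest hyperbolic ball containing \<open>S\<close> exists by compactness, the bound on \<open>S\<close>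
  keeping the admissible radii finite, and it is unique by \<open>hyperbolic_midpoint\<close>. An automorphism under
  which every point of \<open>S\<close> is the image of a point of \<open>S\<close> carries a centre to a centre.
  Because \<open>0 \<in> S\<close>, an admissible centre \<open>w\<close> in the closed ball satisfies
  \<open>1 \<le> t (1 - |w|\<^sup>2)\<close> and so does not lie on the sphere.
\<close>

lemma hyperbolic_circumcentre:
  fixes S :: "(complex ^ 'n) set"
  assumes S: "S \<subseteq> cball 0 r" and r: "r < 1" and S0: "0 \<in> S"
  obtains w where "norm w < 1" "\<And>g h. bihol g h \<Longrightarrow> S \<subseteq> g ` S \<Longrightarrow> g w = w"
proof -
  have r0: "0 \<le> r" using S S0 by auto
  have Sless: "norm z < 1" if "z \<in> S" for z using S r that by auto
  \<comment> \<open>Membership of \<open>S\<close> in the hyperbolic ball of centre \<open>w\<close> whose radius has \<open>cosh\<^sup>2\<close> equal to \<open>t\<close>.\<close>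
  define P where "P w t \<longleftrightarrow> (\<forall>z\<in>S. (cmod (1 - herm w z))\<^sup>2 \<le> t * ((1 - (norm w)\<^sup>2) * (1 - (norm z)\<^sup>2)))" for w t
  define t0 where "t0 = 1 / (1 - r\<^sup>2)"
  have r2: "r\<^sup>2 < 1" using r r0 by (simp add: abs_square_less_1)
  have P0: "P 0 t0"
    unfolding P_def
  proof
    fix z assume "z \<in> S"
    then have "(norm z)\<^sup>2 \<le> r\<^sup>2" using S by (intro power_mono) auto
    then have "1 \<le> t0 * (1 - (norm z)\<^sup>2)" using r2 by (simp add: t0_def)
    then show "(cmod (1 - herm 0 z))\<^sup>2 \<le> t0 * ((1 - (norm (0 :: complex ^ 'n))\<^sup>2) * (1 - (norm z)\<^sup>2))" by simp
  qed
  have Ppos: "0 < t \<and> norm w < 1" if "P w t" "norm w \<le> 1" "0 \<le> t" for w t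
  proof -
    have *: "1 \<le> t * (1 - (norm w)\<^sup>2)" using that(1) S0 by (auto simp: P_def)
    then have "0 < t" using that(3) by (cases "t = 0") auto
    moreover have "norm w \<noteq> 1" using * by auto
    ultimately show ?thesis using that(2) by simp
  qed
  define K where "K = (cball 0 1 \<times> {0..t0}) \<inter> {x. P (fst x) (snd x)}"
  have "closed {x :: (complex ^ 'n) \<times> real. P (fst x) (snd x)}"
    unfolding P_def Ball_def
    by (intro closed_Collect_all closed_Collect_imp closed_Collect_le continuous_intros) auto
  then have "compact K"
    unfolding K_def by (intro compact_Int_closed compact_Times) auto
  moreover have "(0, t0) \<in> K" using P0 r2 by (auto simp: K_def t0_def)
  ultimately obtain x where x: "x \<in> K" "\<And>y. y \<in> K \<Longrightarrow> snd x \<le> snd y"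
    using continuous_attains_inf[of K snd] continuous_on_snd[OF continuous_on_id] by blast
  define w where "w = fst x"
  define m where "m = snd x"
  have Pw: "P w m" "norm w \<le> 1" "0 \<le> m" "m \<le> t0" using x(1) by (auto simp: K_def w_def m_def)
  have min: "m \<le> t" if "P v t" "norm v < 1" "0 \<le> t" for v t
    using x(2)[of "(v, t)"] that Pw(4) unfolding K_def m_def by force
  have m: "0 < m" and w: "norm w < 1" using Ppos[OF Pw(1-3)] by auto
  show thesis
  proof (rule that[OF w])
    fix g h assume b: "bihol g h" and sub: "S \<subseteq> g ` S"
    have gw: "norm (g w) < 1" using b w by (auto simp: bihol_def)
    have "P (g w) m"
      unfolding P_def
    proof
      fix z assume "z \<in> S"
      then obtain y where y: "y \<in> S" "z = g y" using sub by auto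
      have ny: "norm y < 1" "norm z < 1" using Sless \<open>z \<in> S\<close> y by auto
      have pos: "0 < (1 - (norm w)\<^sup>2) * (1 - (norm y)\<^sup>2)" "0 < (1 - (norm (g w))\<^sup>2) * (1 - (norm z)\<^sup>2)"
        using w gw ny by (auto simp: abs_square_less_1)
      have "(cmod (1 - herm (g w) z))\<^sup>2 * ((1 - (norm w)\<^sup>2) * (1 - (norm y)\<^sup>2))
          = (cmod (1 - herm w y))\<^sup>2 * ((1 - (norm (g w))\<^sup>2) * (1 - (norm z)\<^sup>2))"
        using bihol_herm_invariant[OF b w ny(1)] by (simp add: y)
      also have "\<dots> \<le> (m * ((1 - (norm w)\<^sup>2) * (1 - (norm y)\<^sup>2))) * ((1 - (norm (g w))\<^sup>2) * (1 - (norm z)\<^sup>2))"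
        using Pw(1) y(1) pos(2) by (intro mult_right_mono) (auto simp: P_def)
      finally have "(cmod (1 - herm (g w) z))\<^sup>2 * ((1 - (norm w)\<^sup>2) * (1 - (norm y)\<^sup>2))
          \<le> (m * ((1 - (norm (g w))\<^sup>2) * (1 - (norm z)\<^sup>2))) * ((1 - (norm w)\<^sup>2) * (1 - (norm y)\<^sup>2))"
        by (simp only: mult_ac)
      then show "(cmod (1 - herm (g w) z))\<^sup>2 \<le> m * ((1 - (norm (g w))\<^sup>2) * (1 - (norm z)\<^sup>2))"
        using pos(1) by (rule mult_right_le_imp_le)
    qed
    show "g w = w"
    proof (rule ccontr)
      assume "g w \<noteq> w"
      then obtain v t where v: "norm v < 1" "t < m" "P v t"
        using hyperbolic_midpoint[OF gw w _ m, of S] \<open>P (g w) m\<close> Pw(1) unfolding P_def by blast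
      have "1 \<le> t * (1 - (norm v)\<^sup>2)" using v(3) S0 by (auto simp: P_def)
      moreover have "0 < 1 - (norm v)\<^sup>2" using v(1) by (simp add: abs_square_less_1)
      ultimately have "0 \<le> t" by (smt (verit) mult_nonneg_nonneg mult_nonpos_nonneg)
      then show False using min[OF v(3) v(1)] v(2) by simp
    qed
  qed
qed

section \<open>Infinitesimal unitary symmetries\<close>

lemma norm_matrix_vector_le:
  fixes A :: "complex ^ 'n ^ 'm"
  shows "norm (A *v x) \<le> norm A * norm x"
proof -
  define y :: "complex ^ 'n" where "y = (\<chi> j. cnj (x $ j))"
  have ny: "norm y = norm x" by (simp add: y_def norm_vec_def)
  have "norm ((A *v x) $ i) \<le> norm (A $ i) * norm x" for i
    using cmod_herm_le[of "A $ i" y] by (simp add: ny) (simp add: herm_def y_def matrix_vector_mult_def)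
  then have "norm (A *v x) \<le> L2_set (\<lambda>i. norm (A $ i) * norm x) UNIV"
    unfolding norm_vec_def[of "A *v x"] by (intro L2_set_mono) auto
  also have "\<dots> = norm A * norm x"
    by (simp add: L2_set_left_distrib[symmetric] norm_vec_def[of A])
  finally show ?thesis .
qed

lemma norm_matrix_le:
  fixes A :: "complex ^ 'n ^ 'm"
  assumes "\<And>x. norm (A *v x) \<le> c * norm x"
  shows "norm A \<le> real CARD('m) * real CARD('n) * c"
proof -
  have entry: "norm (A $ i $ j) \<le> c" for i j
  proof -
    have "A $ i $ j = (A *v axis j 1) $ i"
      by (simp add: matrix_vector_mult_def axis_def if_distrib sum.If_cases cong: if_cong)
    also have "norm \<dots> \<le> c"
      using order_trans[OF Finite_Cartesian_Product.norm_nth_le assms[of "axis j 1"]]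
      by (simp add: norm_eq_sqrt_inner[of "axis j 1"] inner_axis_axis)
    finally show ?thesis .
  qed
  have "norm A \<le> (\<Sum>i\<in>UNIV. norm (A $ i))"
    unfolding norm_vec_def[of A] by (intro L2_set_le_sum) auto
  also have "\<dots> \<le> (\<Sum>i\<in>(UNIV :: 'm set). real CARD('n) * c)"
  proof (rule sum_mono)
    fix i
    have "norm (A $ i) \<le> (\<Sum>j\<in>UNIV. norm (A $ i $ j))"
      unfolding norm_vec_def[of "A $ i"] by (intro L2_set_le_sum) auto
    also have "\<dots> \<le> (\<Sum>j\<in>(UNIV :: 'n set). c)" by (intro sum_mono entry)
    finally show "norm (A $ i) \<le> real CARD('n) * c" by simp
  qed
  finally show ?thesis by simp
qed

lemma bounded_bilinear_matrix_vector:
  "bounded_bilinear (\<lambda>(A :: complex ^ 'n ^ 'm) x. A *v x)"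
proof
  show "\<exists>K. \<forall>(A :: complex ^ 'n ^ 'm) x. norm (A *v x) \<le> norm A * norm x * K"
    by (intro exI[of _ 1]) (simp add: norm_matrix_vector_le)
qed (simp_all add: matrix_vector_mult_add_rdistrib matrix_vector_right_distrib,
    simp_all add: vec_eq_iff matrix_vector_mult_def scaleR_sum_right)

lemmas tendsto_matrix_vector = bounded_bilinear.tendsto[OF bounded_bilinear_matrix_vector]

lemma norm_preserving_matrix_inverse:
  fixes A :: "complex ^ 'n ^ 'n"
  assumes A: "\<And>x. norm (A *v x) = norm x"
  obtains A' where "A' ** A = mat 1" "A ** A' = mat 1" "\<And>x. norm (A' *v x) = norm x"
proof -
  have "inj ((*v) A)"
  proof (rule injI)
    fix x y assume "A *v x = A *v y"
    then have "norm (x - y) = 0" using A[of "x - y"] by (simp add: matrix_vector_mult_diff_distrib)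
    then show "x = y" by simp
  qed
  then obtain A' where A': "A' ** A = mat 1" using matrix_left_invertible_injective by blast
  then have A'': "A ** A' = mat 1" using matrix_left_right_inverse by blast
  have "norm (A' *v x) = norm x" for x
    using A[of "A' *v x"] A'' by (simp add: matrix_vector_mul_assoc)
  then show thesis using that A' A'' by blast
qed

definition unitary_symmetries ::
  "(complex ^ 'n \<Rightarrow> complex ^ 'm) \<Rightarrow> ((complex ^ 'n ^ 'n) \<times> (complex ^ 'm ^ 'm)) set" where
  "unitary_symmetries F = {(A, B). (\<forall>x. norm (A *v x) = norm x) \<and> (\<forall>y. norm (B *v y) = norm y) \<and>
     (\<forall>z. norm z < 1 \<longrightarrow> F (A *v z) = B *v F z)}"

text \<open>
  The symmetries form a bounded group of matrices. If it is infinite, distinct members come arbitrarily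
  close to each other, and their quotient is a symmetry close to the identity.
\<close>

lemma unitary_symmetries_near_identity:
  fixes F :: "complex ^ 'n \<Rightarrow> complex ^ 'm"
  assumes inf: "infinite (unitary_symmetries F)" and "0 < \<epsilon>"
  shows "\<exists>C \<in> unitary_symmetries F. C \<noteq> (mat 1, mat 1) \<and> norm (C - (mat 1, mat 1)) < \<epsilon>"
proof -
  define kn where "kn = real CARD('n) * real CARD('n)"
  define km where "km = real CARD('m) * real CARD('m)"
  have k: "0 < kn" "0 < km" by (auto simp: kn_def km_def)
  have "unitary_symmetries F \<subseteq> cball 0 (kn + km)"
  proof
    fix C assume C: "C \<in> unitary_symmetries F"
    obtain A B where AB: "C = (A, B)" by (cases C)
    have "norm A \<le> kn * 1" "norm B \<le> km * 1"
      unfolding kn_def km_def using C by (intro norm_matrix_le; simp add: AB unitary_symmetries_def)+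
    then show "C \<in> cball 0 (kn + km)"
      using norm_Pair_le[of A B] by (simp add: AB)
  qed
  then obtain l where "l islimpt unitary_symmetries F"
    using Heine_Borel_imp_Bolzano_Weierstrass[OF compact_cball inf] by blast
  define \<delta> where "\<delta> = \<epsilon> / (4 * (kn + km))"
  have \<delta>: "0 < \<delta>" using k \<open>0 < \<epsilon>\<close> by (simp add: \<delta>_def)
  have inf_ball: "infinite (unitary_symmetries F \<inter> ball l \<delta>)"
    using \<open>l islimpt _\<close> \<delta> by (simp add: islimpt_eq_infinite_ball)
  then obtain P where P: "P \<in> unitary_symmetries F" "P \<in> ball l \<delta>"
    using infinite_imp_nonempty by blast
  have "infinite (unitary_symmetries F \<inter> ball l \<delta> - {P})"
    using inf_ball by (simp add: Diff_infinite_finite)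
  then obtain Q where Q: "Q \<in> unitary_symmetries F" "Q \<in> ball l \<delta>" "Q \<noteq> P"
    using infinite_imp_nonempty by blast
  have dist: "norm (Q - P) < 2 * \<delta>"
    using dist_triangle[of Q P l] P Q by (simp add: dist_norm norm_minus_commute)
  obtain A B where AB: "P = (A, B)" by (cases P)
  obtain A2 B2 where AB2: "Q = (A2, B2)" by (cases Q)
  have A: "norm (A *v x) = norm x" and B: "norm (B *v y) = norm y"
    and F: "norm z < 1 \<Longrightarrow> F (A *v z) = B *v F z" for x y z
    using P(1) by (auto simp: AB unitary_symmetries_def)
  have A2: "norm (A2 *v x) = norm x" and B2: "norm (B2 *v y) = norm y"
    and F2: "norm z < 1 \<Longrightarrow> F (A2 *v z) = B2 *v F z" for x y z
    using Q(1) by (auto simp: AB2 unitary_symmetries_def)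
  obtain A' where A': "A' ** A = mat 1" "A ** A' = mat 1" "\<And>x. norm (A' *v x) = norm x"
    using norm_preserving_matrix_inverse[OF A] by blast
  obtain B' where B': "B' ** B = mat 1" "B ** B' = mat 1" "\<And>x. norm (B' *v x) = norm x"
    using norm_preserving_matrix_inverse[OF B] by blast
  define C where "C = (A2 ** A', B2 ** B')"
  have "C \<in> unitary_symmetries F"
  proof -
    have "F ((A2 ** A') *v z) = (B2 ** B') *v F z" if z: "norm z < 1" for z
    proof -
      have z': "norm (A' *v z) < 1" using z A' by simp
      have "F z = B *v F (A' *v z)"
        using F[OF z'] by (simp add: matrix_vector_mul_assoc A')
      then have "B' *v F z = F (A' *v z)" by (simp add: matrix_vector_mul_assoc B')
      then show ?thesis
        using F2[OF z'] by (simp flip: matrix_vector_mul_assoc)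
    qed
    then show ?thesis
      by (simp add: C_def unitary_symmetries_def A2 B2 A' B' flip: matrix_vector_mul_assoc)
  qed
  moreover have "C \<noteq> (mat 1, mat 1)"
  proof
    assume "C = (mat 1, mat 1)"
    then have "A2 ** A' ** A = A" "B2 ** B' ** B = B" by (auto simp: C_def)
    then have "A2 = A" "B2 = B" by (simp_all add: matrix_mul_assoc[symmetric] A' B')
    then show False using Q(3) by (simp add: AB AB2)
  qed
  moreover have "norm (C - (mat 1, mat 1)) < \<epsilon>"
  proof -
    have "norm (A2 - A) < 2 * \<delta>" "norm (B2 - B) < 2 * \<delta>"
      using dist norm_fst_le[of "A2 - A" "B2 - B"] norm_snd_le[of "B2 - B" "A2 - A"] by (auto simp: AB AB2)
    moreover have "norm (A2 ** A' - mat 1) \<le> kn * norm (A2 - A)"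
      unfolding kn_def
    proof (rule norm_matrix_le)
      fix x
      have "(A2 ** A' - mat 1) *v x = (A2 - A) *v (A' *v x)"
        by (simp only: matrix_vector_mult_diff_rdistrib) (simp add: matrix_vector_mul_assoc A')
      then show "norm ((A2 ** A' - mat 1) *v x) \<le> norm (A2 - A) * norm x"
        using norm_matrix_vector_le[of "A2 - A" "A' *v x"] A'(3) by simp
    qed
    moreover have "norm (B2 ** B' - mat 1) \<le> km * norm (B2 - B)"
      unfolding km_def
    proof (rule norm_matrix_le)
      fix x
      have "(B2 ** B' - mat 1) *v x = (B2 - B) *v (B' *v x)"
        by (simp only: matrix_vector_mult_diff_rdistrib) (simp add: matrix_vector_mul_assoc B')
      then show "norm ((B2 ** B' - mat 1) *v x) \<le> norm (B2 - B) * norm x"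
        using norm_matrix_vector_le[of "B2 - B" "B' *v x"] B'(3) by simp
    qed
    ultimately have "norm (A2 ** A' - mat 1) + norm (B2 ** B' - mat 1) \<le> kn * (2 * \<delta>) + km * (2 * \<delta>)"
      using k by (meson add_mono mult_left_mono less_imp_le order_trans)
    also have "\<dots> = (kn + km) * (2 * \<delta>)" by (simp add: distrib_right)
    also have "\<dots> = \<epsilon> / 2"
    proof -
      have cancel: "K * (2 * (\<epsilon> / (4 * K))) = \<epsilon> / 2" if "K \<noteq> 0" for K using that by simp
      show ?thesis unfolding \<delta>_def by (rule cancel) (use k in simp)
    qed
    also have "\<dots> < \<epsilon>" using \<open>0 < \<epsilon>\<close> by simp
    finally show ?thesis
      using norm_Pair_le[of "A2 ** A' - mat 1" "B2 ** B' - mat 1"] by (simp add: C_def)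
  qed
  ultimately show ?thesis by blast
qed

lemma has_derivative_difference_quotient:
  fixes F :: "'a :: real_normed_vector \<Rightarrow> 'b :: real_normed_vector"
  assumes F: "(F has_derivative D) (at z)" and h: "h \<longlonglongrightarrow> v" and e: "e \<longlonglongrightarrow> 0" "\<And>k. 0 < e k"
  shows "(\<lambda>k. (F (z + e k *\<^sub>R h k) - F z) /\<^sub>R e k) \<longlonglongrightarrow> D v"
proof -
  have D: "bounded_linear D" using F by (rule has_derivative_bounded_linear)
  have eh: "(\<lambda>k. e k *\<^sub>R h k) \<longlonglongrightarrow> 0" using tendsto_scaleR[OF e(1) h] by simp
  obtain b where b: "0 < b" "\<And>k. norm (h k) \<le> b"
    using convergent_imp_Bseq[OF convergentI[OF h]] unfolding Bseq_def by blast
  have "(\<lambda>k. (F (z + e k *\<^sub>R h k) - F z) /\<^sub>R e k - D (h k)) \<longlonglongrightarrow> 0"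
  proof (rule LIMSEQ_I)
    fix r :: real assume r: "0 < r"
    define s where "s = r / (2 * b)"
    have "0 < s" using r b by (simp add: s_def)
    then obtain d where d: "0 < d"
      "\<And>y. norm (y - z) < d \<Longrightarrow> norm (F y - F z - D (y - z)) \<le> s * norm (y - z)"
      using F unfolding has_derivative_at_alt by blast
    obtain N where N: "\<And>k. k \<ge> N \<Longrightarrow> norm (e k *\<^sub>R h k) < d"
      using LIMSEQ_D[OF eh d(1)] by auto
    show "\<exists>no. \<forall>k\<ge>no. norm ((F (z + e k *\<^sub>R h k) - F z) /\<^sub>R e k - D (h k) - 0) < r"
    proof (intro exI allI impI)
      fix k assume "k \<ge> N"
      have "norm (F (z + e k *\<^sub>R h k) - F z - D (e k *\<^sub>R h k)) \<le> s * (e k * norm (h k))"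
        using d(2)[of "z + e k *\<^sub>R h k"] N[OF \<open>k \<ge> N\<close>] e(2)[of k] by simp
      moreover have "(F (z + e k *\<^sub>R h k) - F z) /\<^sub>R e k - D (h k)
          = (F (z + e k *\<^sub>R h k) - F z - D (e k *\<^sub>R h k)) /\<^sub>R e k"
        using e(2)[of k] by (simp add: linear_simps(5)[OF D] algebra_simps)
      ultimately have "norm ((F (z + e k *\<^sub>R h k) - F z) /\<^sub>R e k - D (h k)) \<le> s * norm (h k)"
        using e(2)[of k] by (simp add: pos_divide_le_eq mult_ac divide_inverse_commute[symmetric])
      also have "\<dots> \<le> s * b" using b(2) \<open>0 < s\<close> by (intro mult_left_mono) auto
      also have "\<dots> < r" using r b by (simp add: s_def)
      finally show "norm ((F (z + e k *\<^sub>R h k) - F z) /\<^sub>R e k - D (h k) - 0) < r" by simp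
    qed
  qed
  from tendsto_add[OF this bounded_linear.tendsto[OF D h]] show ?thesis by simp
qed

text \<open>
  Symmetries tending to the identity, with their differences from the identity rescaled to norm one, have a
  limiting direction \<open>(X, Y)\<close> by compactness. Passing to the limit in the preservation of norms and in
  \<open>F \<circ> A = B \<circ> F\<close> gives the linearised equations. The pair takes the place of the
  generator of a one-parameter subgroup.
\<close>

lemma infinitesimal_symmetry:
  fixes F :: "complex ^ 'n \<Rightarrow> complex ^ 'm"
  assumes inf: "infinite (unitary_symmetries F)"
  obtains X Y where "(X, Y) \<noteq> 0" "\<And>x. inner (X *v x) x = 0"
    "\<And>z D. norm z < 1 \<Longrightarrow> (F has_derivative D) (at z) \<Longrightarrow> D (X *v z) = Y *v F z"
proof -
  have "\<forall>k. \<exists>C. C \<in> unitary_symmetries F \<and> C \<noteq> (mat 1, mat 1) \<and>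
      norm (C - (mat 1, mat 1)) < inverse (real (Suc k))"
    using unitary_symmetries_near_identity[OF inf] by (metis inverse_positive_iff_positive of_nat_0_less_iff zero_less_Suc)
  then obtain C where C: "\<And>k. C k \<in> unitary_symmetries F" "\<And>k. C k \<noteq> (mat 1, mat 1)"
    "\<And>k. norm (C k - (mat 1, mat 1)) < inverse (real (Suc k))"
    by metis
  define e where "e k = norm (C k - (mat 1, mat 1))" for k
  have e: "0 < e k" for k using C(2) by (simp add: e_def)
  have e0: "e \<longlonglongrightarrow> 0"
    by (rule tendsto_sandwich[OF _ _ tendsto_const LIMSEQ_inverse_real_of_nat])
      (use e C(3) in \<open>auto simp: e_def less_imp_le intro!: always_eventually\<close>)
  define N where "N k = (C k - (mat 1, mat 1)) /\<^sub>R e k" for k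
  have "N k \<in> sphere 0 1" for k using e[of k] by (simp add: N_def) (simp add: e_def)
  then obtain l r where l: "l \<in> sphere 0 1" and r: "strict_mono r" and lim: "(N \<circ> r) \<longlonglongrightarrow> l"
    using compact_sphere[unfolded compact_def] by (metis)
  define X where "X = fst l"
  define Y where "Y = snd l"
  define Xk where "Xk k = fst (N (r k))" for k
  define Yk where "Yk k = snd (N (r k))" for k
  define d where "d k = e (r k)" for k
  have d: "0 < d k" for k using e by (simp add: d_def)
  have d0: "d \<longlonglongrightarrow> 0" using LIMSEQ_subseq_LIMSEQ[OF e0 r] by (simp add: d_def[abs_def] comp_def)
  have Xlim: "Xk \<longlonglongrightarrow> X" and Ylim: "Yk \<longlonglongrightarrow> Y"
    using tendsto_fst[OF lim] tendsto_snd[OF lim] by (simp_all add: Xk_def[abs_def] Yk_def[abs_def] X_def Y_def comp_def)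
  have CN: "C (r k) = (mat 1 + d k *\<^sub>R Xk k, mat 1 + d k *\<^sub>R Yk k)" for k
    using d[of k] by (simp add: Xk_def Yk_def N_def d_def[symmetric] prod_eq_iff)
  have sc: "(c *\<^sub>R A) *v x = c *\<^sub>R (A *v x)" for c and A :: "complex ^ 'k ^ 'l" and x
    by (rule bounded_bilinear.scaleR_left[OF bounded_bilinear_matrix_vector])
  have unit: "norm (x + d k *\<^sub>R (Xk k *v x)) = norm x" for k x
    using C(1)[of "r k"] by (simp add: unitary_symmetries_def CN matrix_vector_mult_add_rdistrib sc)
  have sym: "F (z + d k *\<^sub>R (Xk k *v z)) = F z + d k *\<^sub>R (Yk k *v F z)" if "norm z < 1" for k z
    using C(1)[of "r k"] that by (simp add: unitary_symmetries_def CN matrix_vector_mult_add_rdistrib sc)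
  show thesis
  proof (rule that)
    have "l = (X, Y)" by (simp add: X_def Y_def)
    moreover have "norm l = 1" using l by simp
    ultimately show "(X, Y) \<noteq> 0" by auto
    show "inner (X *v x) x = 0" for x
    proof -
      have v: "(\<lambda>k. Xk k *v x) \<longlonglongrightarrow> X *v x" by (intro tendsto_matrix_vector Xlim tendsto_const)
      have "2 * inner (Xk k *v x) x + d k * (norm (Xk k *v x))\<^sup>2 = 0" for k
      proof -
        have "(norm (x + d k *\<^sub>R (Xk k *v x)))\<^sup>2
            = (norm x)\<^sup>2 + d k * (2 * inner (Xk k *v x) x + d k * (norm (Xk k *v x))\<^sup>2)"
          by (simp add: power2_norm_eq_inner inner_simps inner_commute algebra_simps)
        then show ?thesis using d[of k] unfolding unit by simp
      qed
      moreover have "(\<lambda>k. 2 * inner (Xk k *v x) x + d k * (norm (Xk k *v x))\<^sup>2)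
          \<longlonglongrightarrow> 2 * inner (X *v x) x + 0 * (norm (X *v x))\<^sup>2"
        by (intro tendsto_intros v d0)
      ultimately show ?thesis by (simp add: LIMSEQ_const_iff)
    qed
    show "D (X *v z) = Y *v F z" if z: "norm z < 1" and D: "(F has_derivative D) (at z)" for z D
    proof -
      have "(\<lambda>k. (F (z + d k *\<^sub>R (Xk k *v z)) - F z) /\<^sub>R d k) \<longlonglongrightarrow> D (X *v z)"
        by (intro has_derivative_difference_quotient[OF D _ d0 d] tendsto_matrix_vector Xlim tendsto_const)
      moreover have "(F (z + d k *\<^sub>R (Xk k *v z)) - F z) /\<^sub>R d k = Yk k *v F z" for k
        using d[of k] by (simp add: sym[OF z])
      moreover have "(\<lambda>k. Yk k *v F z) \<longlonglongrightarrow> Y *v F z"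
        by (intro tendsto_matrix_vector Ylim tendsto_const)
      ultimately show ?thesis by (simp add: LIMSEQ_unique)
    qed
  qed
qed

text \<open>
  The maximum of the Rayleigh quotient is an eigenvalue, and it is positive since the quotient takes a positive
  value.
\<close>

lemma symmetric_operator_eigenvector:
  fixes T :: "'a :: euclidean_space \<Rightarrow> 'a"
  assumes lin: "linear T" and sym: "\<And>x y. inner (T x) y = inner x (T y)" and pos: "0 < inner (T x0) x0"
  obtains v M where "v \<noteq> 0" "0 < M" "T v = M *\<^sub>R v"
proof -
  have "x0 \<noteq> 0" using pos by auto
  have cont: "continuous_on (sphere 0 1) (\<lambda>x. inner (T x) x)"
    using lin by (intro continuous_intros linear_continuous_on) (simp add: linear_conv_bounded_linear)
  have ne: "sgn x0 \<in> sphere 0 1" using \<open>x0 \<noteq> 0\<close> by (simp add: norm_sgn)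
  obtain v where v: "v \<in> sphere 0 1" and max: "\<And>x. x \<in> sphere 0 1 \<Longrightarrow> inner (T x) x \<le> inner (T v) v"
    using continuous_attains_sup[OF compact_sphere _ cont] ne by blast
  define M where "M = inner (T v) v"
  have vv: "inner v v = 1" using v by (simp add: norm_eq_1)
  have le: "inner (T x) x \<le> M * inner x x" for x
  proof (cases "x = 0")
    case False
    have "inner (T (sgn x)) (sgn x) \<le> M" using max[of "sgn x"] False by (simp add: norm_sgn M_def)
    then show ?thesis
      using False by (simp add: sgn_div_norm linear_scale[OF lin] field_simps flip: power2_norm_eq_inner)
        (simp add: power2_eq_square mult_ac)
  qed (simp add: linear_0[OF lin])
  have "0 < M"
    using le[of x0] pos inner_gt_zero_iff[of x0] \<open>x0 \<noteq> 0\<close> by (smt (verit) mult_nonpos_nonneg)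
  define w where "w = M *\<^sub>R v - T v"
  define b where "b = inner w w"
  define c where "c = M * b - inner (T w) w"
  \<comment> \<open>The form \<open>M |x|\<^sup>2 - \<langle>T x, x\<rangle>\<close> is nonnegative and vanishes at \<open>v\<close>, so its first-order term at \<open>v\<close> must vanish; it is tested in the direction \<open>w\<close>.\<close>
  have quad: "0 \<le> 2 * t * b + t\<^sup>2 * c" for t
  proof -
    have Tw: "inner (T w) v = inner w (T v)" using sym by simp
    have b': "b = M * inner w v - inner w (T v)"
      using arg_cong[OF w_def, of "inner w"] by (simp add: b_def inner_diff_right)
    have "0 \<le> M * inner (v + t *\<^sub>R w) (v + t *\<^sub>R w) - inner (T (v + t *\<^sub>R w)) (v + t *\<^sub>R w)"
      using le by simp
    also have "\<dots> = 2 * t * (M * inner w v - inner w (T v)) + t\<^sup>2 * c"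
      by (simp add: linear_add[OF lin] linear_scale[OF lin] inner_simps Tw vv M_def[symmetric] c_def b_def
          inner_commute[of v w] inner_commute[of "T v" w] power2_eq_square algebra_simps)
    finally show ?thesis by (simp only: b'[symmetric])
  qed
  have "b \<le> 0"
  proof (rule ccontr)
    assume "\<not> b \<le> 0"
    then have "0 < b" by simp
    define s where "s = b / (1 + \<bar>c\<bar>)"
    have "0 < s" using \<open>0 < b\<close> by (simp add: s_def add_pos_nonneg)
    have "s * \<bar>c\<bar> < b" using \<open>0 < b\<close> by (simp add: s_def field_simps)
    moreover have "s * c \<le> s * \<bar>c\<bar>" using \<open>0 < s\<close> by (intro mult_left_mono) auto
    ultimately have "s * (s * c - 2 * b) < 0" using \<open>0 < s\<close> \<open>0 < b\<close> by (intro mult_pos_neg) linarith+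
    then show False using quad[of "- s"] by (simp add: power2_eq_square algebra_simps)
  qed
  then have "w = 0" using inner_ge_zero[of w] unfolding b_def
    by (metis antisym inner_eq_zero_iff)
  then have "T v = M *\<^sub>R v" by (simp add: w_def)
  moreover have "v \<noteq> 0" using v by auto
  ultimately show thesis using that \<open>0 < M\<close> by blast
qed

text \<open>
  The operator \<open>-\<i> X\<close> is symmetric for the real inner product. It or its negative has a positive value of the
  quadratic form, since a symmetric operator with vanishing form is zero.
\<close>

lemma skew_matrix_eigenvector:
  fixes X :: "complex ^ 'n ^ 'n"
  assumes skew: "\<And>x. inner (X *v x) x = 0" and "X \<noteq> 0"
  obtains v M where "v \<noteq> 0" "M \<noteq> 0" "X *v v = (\<i> * complex_of_real M) *s v"
proof -
  define T where "T x = (- \<i>) *s (X *v x)" for x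
  have lin: "linear T"
    by (rule linearI) (simp_all add: T_def matrix_vector_right_distrib vector_add_ldistrib scaleR_eq_scale
        vector_scalar_commute mult.commute)
  have polar: "inner (X *v x) y = - inner x (X *v y)" for x y
    using skew[of "x + y"] skew[of x] skew[of y]
    by (simp add: matrix_vector_right_distrib inner_simps inner_commute)
  have im: "inner ((- \<i>) *s x) y = - inner x ((- \<i>) *s y)" for x y :: "complex ^ 'n"
    unfolding inner_eq_Re_herm herm_scale_left herm_scale_right by simp
  have sym: "inner (T x) y = inner x (T y)" for x y
    unfolding T_def im polar vector_scalar_commute by simp
  have "\<exists>x. inner (T x) x \<noteq> 0"
  proof (rule ccontr)
    assume "\<not> ?thesis"
    then have z: "inner (T x) x = 0" for x by blast
    have "inner (T x) y = 0" for x y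
      using z[of "x + y"] z[of x] z[of y] sym[of x y]
      by (simp add: linear_add[OF lin] inner_simps inner_commute)
    then have "T x = 0" for x by (metis inner_eq_zero_iff)
    then have "X *v x = 0" for x by (simp add: T_def)
    then show False using \<open>X \<noteq> 0\<close> by (simp add: matrix_eq)
  qed
  then obtain x where x: "inner (T x) x \<noteq> 0" by blast
  have eig: "X *v v = (\<i> * complex_of_real M) *s v" if "T v = M *\<^sub>R v" for v M
  proof -
    have "X *v v = \<i> *s T v" by (simp add: T_def)
    then show ?thesis using that by (simp add: scaleR_eq_scale)
  qed
  have key: thesis if "v \<noteq> 0" "M \<noteq> 0" "T v = M *\<^sub>R v" for v M
    using \<open>\<And>v M. \<lbrakk>v \<noteq> 0; M \<noteq> 0; X *v v = (\<i> * complex_of_real M) *s v\<rbrakk> \<Longrightarrow> thesis\<close>[OF that(1,2) eig[OF that(3)]] .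
  show thesis
  proof (cases "0 < inner (T x) x")
    case True
    then show thesis using symmetric_operator_eigenvector[OF lin sym] key by (metis less_numeral_extra(3))
  next
    case False
    then have "0 < inner (- T x) x" using x by simp
    moreover have "linear (\<lambda>x. - T x)" using lin by (rule linear_compose_neg)
    moreover have "inner (- T x) y = inner x (- T y)" for x y using sym by simp
    ultimately obtain v M where "v \<noteq> 0" "0 < M" "- T v = M *\<^sub>R v"
      using symmetric_operator_eigenvector[of "\<lambda>x. - T x" x] by blast
    then show thesis using key[of v "- M"] by (metis add.inverse_inverse neg_equal_0_iff_equal less_numeral_extra(3) scaleR_minus_left)
  qed
qed

section \<open>Polynomial and rational maps along lines\<close>

lemma Euler_system_higher_deriv:
  fixes u :: "'m :: finite \<Rightarrow> complex \<Rightarrow> complex" and Y :: "complex ^ 'm ^ 'm"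
  assumes hol: "\<And>j. u j holomorphic_on ball 0 R"
    and ode: "\<And>j t. t \<in> ball 0 R \<Longrightarrow> \<mu> * (t * deriv (u j) t) = (\<Sum>l\<in>UNIV. Y $ j $ l * u l t)"
    and "t \<in> ball 0 R"
  shows "\<mu> * (t * (deriv ^^ Suc k) (u j) t + of_nat k * (deriv ^^ k) (u j) t)
       = (\<Sum>l\<in>UNIV. Y $ j $ l * (deriv ^^ k) (u l) t)"
  using \<open>t \<in> ball 0 R\<close>
proof (induction k arbitrary: t)
  case 0
  then show ?case using ode by simp
next
  case (Suc k)
  have der: "((deriv ^^ i) (u l) has_field_derivative (deriv ^^ Suc i) (u l) t) (at t)" for i l
    using holomorphic_derivI[OF holomorphic_higher_deriv[OF hol open_ball] open_ball Suc.prems] by simp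
  have "((\<lambda>t. \<mu> * (t * (deriv ^^ Suc k) (u j) t + of_nat k * (deriv ^^ k) (u j) t)) has_field_derivative
      \<mu> * (t * (deriv ^^ Suc (Suc k)) (u j) t + of_nat (Suc k) * (deriv ^^ Suc k) (u j) t)) (at t)"
    by (rule derivative_eq_intros der refl)+ (simp add: algebra_simps)
  from has_field_derivative_transform_within_open[OF this open_ball Suc.prems Suc.IH]
  have "((\<lambda>t. \<Sum>l\<in>UNIV. Y $ j $ l * (deriv ^^ k) (u l) t) has_field_derivative
      \<mu> * (t * (deriv ^^ Suc (Suc k)) (u j) t + of_nat (Suc k) * (deriv ^^ Suc k) (u j) t)) (at t)" .
  moreover have "((\<lambda>t. \<Sum>l\<in>UNIV. Y $ j $ l * (deriv ^^ k) (u l) t) has_field_derivative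
      (\<Sum>l\<in>UNIV. Y $ j $ l * (deriv ^^ Suc k) (u l) t)) (at t)"
    by (intro DERIV_sum DERIV_cmult der)
  ultimately show ?case by (rule DERIV_unique)
qed

text \<open>
  Differentiating the system \<open>k\<close> times at \<open>0\<close> shows that the \<open>k\<close>-th Taylor coefficient is an
  eigenvector of \<open>Y\<close> for \<open>k \<mu>\<close>, or zero. The eigenvalues of \<open>Y\<close> are bounded by its norm, so
  only finitely many coefficients survive.
\<close>

lemma Euler_system_polynomial:
  fixes u :: "'m :: finite \<Rightarrow> complex \<Rightarrow> complex" and Y :: "complex ^ 'm ^ 'm"
  assumes hol: "\<And>j. u j holomorphic_on ball 0 R" and "0 < R" and "\<mu> \<noteq> 0"
    and ode: "\<And>j t. t \<in> ball 0 R \<Longrightarrow> \<mu> * (t * deriv (u j) t) = (\<Sum>l\<in>UNIV. Y $ j $ l * u l t)"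
  shows "\<exists>d c. \<forall>j. \<forall>t\<in>ball 0 R. u j t = (\<Sum>k\<le>d. t ^ k * c k $ j)"
proof -
  define c :: "nat \<Rightarrow> complex ^ 'm" where "c k = (\<chi> j. (deriv ^^ k) (u j) 0 / fact k)" for k
  have eig: "Y *v c k = (\<mu> * of_nat k) *s c k" for k
  proof (rule vec_eq_iff[THEN iffD2], rule allI)
    fix j
    have "(\<Sum>l\<in>UNIV. Y $ j $ l * (deriv ^^ k) (u l) 0) = \<mu> * of_nat k * (deriv ^^ k) (u j) 0"
      using Euler_system_higher_deriv[OF hol ode, of 0 k j] \<open>0 < R\<close> by (simp add: mult.assoc)
    then have "(\<Sum>l\<in>UNIV. Y $ j $ l * (deriv ^^ k) (u l) 0) / fact k = \<mu> * of_nat k * (deriv ^^ k) (u j) 0 / fact k"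
      by simp
    then show "(Y *v c k) $ j = ((\<mu> * of_nat k) *s c k) $ j"
      by (simp add: matrix_vector_mult_def c_def sum_divide_distrib)
  qed
  define d where "d = nat \<lceil>norm Y / cmod \<mu>\<rceil>"
  have zero: "c k = 0" if "d < k" for k
  proof (rule ccontr)
    assume "c k \<noteq> 0"
    have "cmod \<mu> * real k * norm (c k) \<le> norm Y * norm (c k)"
      using norm_matrix_vector_le[of Y "c k"] by (simp add: eig norm_scale norm_mult)
    then have "real k \<le> norm Y / cmod \<mu>"
      using \<open>c k \<noteq> 0\<close> \<open>\<mu> \<noteq> 0\<close> by (simp add: field_simps)
    then show False using that by (simp add: d_def) linarith
  qed
  have "u j t = (\<Sum>k\<le>d. t ^ k * c k $ j)" if "t \<in> ball 0 R" for j t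
  proof -
    have "(\<lambda>k. (deriv ^^ k) (u j) 0 / fact k * (t - 0) ^ k) sums u j t"
      by (rule holomorphic_power_series[OF hol that])
    moreover have "(\<lambda>k. (deriv ^^ k) (u j) 0 / fact k * (t - 0) ^ k) = (\<lambda>k. t ^ k * c k $ j)"
      by (simp add: c_def fun_eq_iff)
    moreover have "(\<lambda>k. t ^ k * c k $ j) sums (\<Sum>k\<le>d. t ^ k * c k $ j)"
      by (rule sums_finite) (auto simp: zero not_le)
    ultimately show ?thesis using sums_unique2 by metis
  qed
  then show ?thesis by blast
qed

lemma polynomial_fun_monomial: "polynomial_fun (\<lambda>z. c * (\<Prod>i\<in>UNIV. z $ i ^ \<alpha> i))"
  unfolding polynomial_fun_def by (intro exI[of _ "{\<alpha>}"] exI[of _ "\<lambda>_. c"]) simp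

lemma polynomial_fun_const: "polynomial_fun (\<lambda>z. c)"
  using polynomial_fun_monomial[of c "\<lambda>_. 0"] by simp

lemma polynomial_fun_nth: "polynomial_fun (\<lambda>z. z $ i)"
  using polynomial_fun_monomial[of 1 "\<lambda>j. if j = i then 1 else 0"]
  by (simp add: if_distrib cong: if_cong)

lemma polynomial_fun_add:
  assumes "polynomial_fun p" "polynomial_fun q"
  shows "polynomial_fun (\<lambda>z. p z + q z)"
proof -
  obtain A c where A: "finite A" "p = (\<lambda>z. \<Sum>\<alpha>\<in>A. c \<alpha> * (\<Prod>i\<in>UNIV. z $ i ^ \<alpha> i))"
    using assms(1) unfolding polynomial_fun_def by blast
  obtain B d where B: "finite B" "q = (\<lambda>z. \<Sum>\<alpha>\<in>B. d \<alpha> * (\<Prod>i\<in>UNIV. z $ i ^ \<alpha> i))"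
    using assms(2) unfolding polynomial_fun_def by blast
  define e where "e \<alpha> = (if \<alpha> \<in> A then c \<alpha> else 0) + (if \<alpha> \<in> B then d \<alpha> else 0)" for \<alpha>
  have "p z + q z = (\<Sum>\<alpha>\<in>A \<union> B. e \<alpha> * (\<Prod>i\<in>UNIV. z $ i ^ \<alpha> i))" for z
  proof -
    have "p z = (\<Sum>\<alpha>\<in>A \<union> B. (if \<alpha> \<in> A then c \<alpha> else 0) * (\<Prod>i\<in>UNIV. z $ i ^ \<alpha> i))"
      unfolding A(2) using A(1) B(1) by (intro sum.mono_neutral_cong_left) auto
    moreover have "q z = (\<Sum>\<alpha>\<in>A \<union> B. (if \<alpha> \<in> B then d \<alpha> else 0) * (\<Prod>i\<in>UNIV. z $ i ^ \<alpha> i))"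
      unfolding B(2) using A(1) B(1) by (intro sum.mono_neutral_cong_left) auto
    ultimately show ?thesis by (simp add: e_def distrib_right sum.distrib)
  qed
  then show ?thesis
    unfolding polynomial_fun_def using A(1) B(1)
    by (intro exI[of _ "A \<union> B"] exI[of _ e]) (simp add: fun_eq_iff)
qed

lemma polynomial_fun_sum:
  assumes "finite I" "\<And>i. i \<in> I \<Longrightarrow> polynomial_fun (p i)"
  shows "polynomial_fun (\<lambda>z. \<Sum>i\<in>I. p i z)"
  using assms by (induction I) (auto intro: polynomial_fun_const polynomial_fun_add)

lemma polynomial_fun_mult:
  assumes "polynomial_fun p" "polynomial_fun q"
  shows "polynomial_fun (\<lambda>z. p z * q z)"
proof -
  obtain A c where A: "finite A" "p = (\<lambda>z. \<Sum>\<alpha>\<in>A. c \<alpha> * (\<Prod>i\<in>UNIV. z $ i ^ \<alpha> i))"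
    using assms(1) unfolding polynomial_fun_def by blast
  obtain B d where B: "finite B" "q = (\<lambda>z. \<Sum>\<alpha>\<in>B. d \<alpha> * (\<Prod>i\<in>UNIV. z $ i ^ \<alpha> i))"
    using assms(2) unfolding polynomial_fun_def by blast
  have "(\<lambda>z. p z * q z) = (\<lambda>z. \<Sum>\<alpha>\<in>A. \<Sum>\<beta>\<in>B. (c \<alpha> * d \<beta>) * (\<Prod>i\<in>UNIV. z $ i ^ (\<alpha> i + \<beta> i)))"
    by (simp add: A(2) B(2) fun_eq_iff sum_product power_add prod.distrib mult_ac)
  then show ?thesis
    by (simp only:) (intro polynomial_fun_sum A(1) B(1) polynomial_fun_monomial)
qed

lemma polynomial_fun_power: "polynomial_fun p \<Longrightarrow> polynomial_fun (\<lambda>z. p z ^ k)"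
  by (induction k) (auto intro: polynomial_fun_const polynomial_fun_mult)

lemma polynomial_fun_diff:
  assumes "polynomial_fun p" "polynomial_fun q"
  shows "polynomial_fun (\<lambda>z. p z - q z)"
  using polynomial_fun_add[OF assms(1) polynomial_fun_mult[OF polynomial_fun_const[of "-1"] assms(2)]]
  by simp

lemma polynomial_fun_herm:
  assumes "\<And>j. polynomial_fun (\<lambda>z. p z $ j)"
  shows "polynomial_fun (\<lambda>z. herm (p z) w)"
  unfolding herm_def by (intro polynomial_fun_sum polynomial_fun_mult polynomial_fun_const assms) simp

lemmas polynomial_fun_intros = polynomial_fun_const polynomial_fun_nth polynomial_fun_add
  polynomial_fun_diff polynomial_fun_mult polynomial_fun_power polynomial_fun_sum polynomial_fun_herm

text \<open>
  The linear part of the numerator of the involution, up to sign. It shows that the involution maps each line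
  through \<open>a\<close> into a line through \<open>0\<close>, every such line arising in this way.
\<close>

definition ball_involution_lin :: "complex ^ 'n \<Rightarrow> complex ^ 'n \<Rightarrow> complex ^ 'n" where
  "ball_involution_lin a x = of_real (sqrt (1 - (norm a)\<^sup>2)) *s x
     + (herm x a / of_real (1 + sqrt (1 - (norm a)\<^sup>2))) *s a"

lemma ball_involution_lin_add: "ball_involution_lin a (x + y) = ball_involution_lin a x + ball_involution_lin a y"
  by (simp add: ball_involution_lin_def herm_simps add_divide_distrib vec_eq_iff algebra_simps)

lemma ball_involution_lin_scale: "ball_involution_lin a (c *s x) = c *s ball_involution_lin a x"
  by (simp add: ball_involution_lin_def herm_simps vec_eq_iff algebra_simps)

lemma ball_involution_lin_surj:
  fixes a v :: "complex ^ 'n"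
  assumes a: "norm a < 1"
  obtains x where "ball_involution_lin a x = v"
proof
  define s where "s = sqrt (1 - (norm a)\<^sup>2)"
  have "(norm a)\<^sup>2 < 1" using a by (simp add: abs_square_less_1)
  then have s2: "s\<^sup>2 = 1 - (norm a)\<^sup>2" and s0: "0 < s" by (auto simp: s_def)
  have s1: "1 + complex_of_real s \<noteq> 0" "complex_of_real s \<noteq> 0" using s0 by (auto simp: complex_eq_iff)
  have na: "herm a a = 1 - (of_real s)\<^sup>2" using s2 by (simp add: herm_self flip: of_real_power)
  define x where "x = inverse (of_real s) *s (v - (herm v a / of_real (1 + s)) *s a)"
  have "herm x a = herm v a"
    using s1 unfolding x_def herm_simps na by (simp add: divide_simps) (simp add: algebra_simps power2_eq_square)
  then show "ball_involution_lin a x = v"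
    unfolding ball_involution_lin_def s_def[symmetric] using s1 by (simp add: x_def vec_eq_iff)
qed

lemma ball_involution_eq_ball_involution_lin:
  fixes a z :: "complex ^ 'n"
  assumes a: "norm a < 1"
  shows "ball_involution a z = - inverse (1 - herm z a) *s ball_involution_lin a (z - a)"
proof -
  define s where "s = sqrt (1 - (norm a)\<^sup>2)"
  define h where "h = herm z a"
  have "(norm a)\<^sup>2 < 1" using a by (simp add: abs_square_less_1)
  then have s2: "s\<^sup>2 = 1 - (norm a)\<^sup>2" and s0: "0 < s" by (auto simp: s_def)
  have s1: "1 + complex_of_real s \<noteq> 0" using s0 by (auto simp: complex_eq_iff)
  have na: "herm a a = 1 - (of_real s)\<^sup>2" using s2 by (simp add: herm_self flip: of_real_power)
  have "(h - (1 - (of_real s)\<^sup>2)) / of_real (1 + s) = h / of_real (1 + s) - 1 + of_real s"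
    using s1 by (simp add: divide_simps) (simp add: algebra_simps power2_eq_square)
  then have *: "(h - herm a a) / of_real (1 + s) = h / of_real (1 + s) - 1 + of_real s"
    by (simp only: na)
  have "(1 - h / of_real (1 + s)) *s a - of_real s *s z = - ball_involution_lin a (z - a)"
    unfolding ball_involution_lin_def s_def[symmetric] herm_diff_left h_def[symmetric] *
    by (simp add: vec_eq_iff algebra_simps)
  then have "ball_involution a z = inverse (1 - h) *s (- ball_involution_lin a (z - a))"
    unfolding ball_involution_def s_def[symmetric] h_def[symmetric] by (rule arg_cong)
  then show ?thesis by (simp add: h_def vec_eq_iff)
qed

text \<open>
  The line through \<open>0\<close> spanned by \<open>v\<close> corresponds under the involution at \<open>a\<close> to the line
  \<open>a + \<complex> e\<close>, on which the parameter \<open>t\<close> is the linear fractional function \<open>-\<eta> / q0\<close>. So \<open>f\<close> is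
  the composite of a linear fractional map, a polynomial of degree at most \<open>d\<close>, and the linear fractional
  involution at \<open>b\<close>. Multiplying numerator and denominator by \<open>q0 ^ d\<close> makes both polynomial.
\<close>

lemma rational_on_line:
  fixes f :: "complex ^ 'n \<Rightarrow> complex ^ 'm" and a v :: "complex ^ 'n"
  assumes a: "norm a < 1" and b: "norm b < 1" and "v \<noteq> 0"
    and F: "\<And>z. norm z < 1 \<Longrightarrow> norm (F z) < 1"
    and pol: "\<And>t. norm (t *s v) < 1 \<Longrightarrow> F (t *s v) = (\<Sum>k\<le>d. t ^ k *s c k)"
    and f: "\<And>w. norm w < 1 \<Longrightarrow> f w = ball_involution b (F (ball_involution a w))"
  shows "\<exists>V. complex_affine_dim V 1 \<and> V \<inter> unit_ball \<noteq> {} \<and> rational_map_on f (V \<inter> unit_ball)"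
proof -
  obtain e where e: "ball_involution_lin a e = v" using ball_involution_lin_surj[OF a] .
  have "e \<noteq> 0" using e \<open>v \<noteq> 0\<close> by (auto simp: ball_involution_lin_def)
  define s where "s = complex_of_real (sqrt (1 - (norm b)\<^sup>2))"
  define V where "V = (\<lambda>w. a + w) ` vec.span {e}"
  define \<eta> where "\<eta> w = herm (w - a) e / of_real ((norm e)\<^sup>2)" for w
  define q0 where "q0 w = 1 - herm w a" for w
  define P where "P w = (\<Sum>k\<le>d. ((- \<eta> w) ^ k * q0 w ^ (d - k)) *s c k)" for w
  define q where "q w = q0 w ^ d - herm (P w) b" for w
  define p where "p w = (q0 w ^ d - herm (P w) b / (1 + s)) *s b - s *s P w" for w
  have "complex_affine_dim V 1"
    unfolding complex_affine_dim_def V_def using \<open>e \<noteq> 0\<close>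
    by (intro exI[of _ a] exI[of _ "vec.span {e}"]) (simp add: vec.dim_eq_card_independent)
  moreover have "a \<in> V \<inter> unit_ball" using a vec.span_zero by (force simp: V_def)
  moreover have main: "q w \<noteq> 0 \<and> f w = inverse (q w) *s p w" if w: "w \<in> V \<inter> unit_ball" for w
  proof -
    have w1: "norm w < 1" using w by simp
    obtain h where h: "w = a + h *s e" using w by (auto simp: V_def vec.span_singleton)
    have \<eta>: "\<eta> w = h" using \<open>e \<noteq> 0\<close> by (simp add: h \<eta>_def herm_simps herm_self)
    have q0: "q0 w \<noteq> 0" using one_minus_herm_nonzero[of w a] w1 a by (simp add: q0_def)
    define t where "t = - h / q0 w"
    have m: "ball_involution a w = t *s v"
      using ball_involution_eq_ball_involution_lin[OF a, of w]
      by (simp add: h ball_involution_lin_scale e t_def q0_def divide_inverse mult.commute)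
    have t1: "norm (t *s v) < 1" using norm_ball_involution_less_1[OF a w1] m by simp
    define y where "y = F (t *s v)"
    have y1: "norm y < 1" unfolding y_def using F[OF t1] .
    have fy: "f w = ball_involution b y" using f[OF w1] m by (simp add: y_def)
    have P: "P w = q0 w ^ d *s y"
    proof -
      have "(- h) ^ k * q0 w ^ (d - k) = q0 w ^ d * t ^ k" if "k \<le> d" for k
      proof -
        have "q0 w ^ d = q0 w ^ k * q0 w ^ (d - k)" using that by (simp flip: power_add)
        moreover have "(- h) ^ k = q0 w ^ k * t ^ k"
          using q0 by (simp add: t_def flip: power_mult_distrib)
        ultimately show ?thesis by (simp add: mult_ac)
      qed
      then show ?thesis
        by (simp add: P_def y_def pol[OF t1] \<eta> vec_eq_iff sum_distrib_left mult.assoc)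
    qed
    have q: "q w = q0 w ^ d * (1 - herm y b)"
      by (simp add: q_def P herm_simps algebra_simps)
    have p: "p w = q0 w ^ d *s ((1 - herm y b / (1 + s)) *s b - s *s y)"
      by (simp add: p_def P herm_simps vec_eq_iff algebra_simps)
    have "1 - herm y b \<noteq> 0" using one_minus_herm_nonzero[of y b] y1 b by simp
    then have "q w \<noteq> 0" using q0 by (simp add: q)
    moreover have "f w = inverse (q w) *s p w"
    proof -
      have "ball_involution b y = inverse (1 - herm y b) *s ((1 - herm y b / (1 + s)) *s b - s *s y)"
        by (simp add: ball_involution_def s_def)
      moreover have "inverse (q w) * q0 w ^ d = inverse (1 - herm y b)" using q0 by (simp add: q)
      ultimately show ?thesis by (simp only: fy p vector_smult_assoc)
    qed
    ultimately show ?thesis by blast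
  qed
  moreover have "rational_map_on f (V \<inter> unit_ball)"
  proof -
    have "polynomial_fun q0" unfolding q0_def[abs_def] by (intro polynomial_fun_intros)
    moreover have "polynomial_fun \<eta>"
      unfolding \<eta>_def[abs_def] divide_inverse vector_minus_component
      by (intro polynomial_fun_intros) (simp, intro polynomial_fun_intros)
    ultimately have P: "polynomial_fun (\<lambda>w. P w $ j)" for j
      unfolding P_def sum_component vector_smult_component
      using polynomial_fun_mult[OF polynomial_fun_const[of "-1"] \<open>polynomial_fun \<eta>\<close>]
      by (intro polynomial_fun_intros) auto
    have "polynomial_fun q" unfolding q_def[abs_def] by (intro polynomial_fun_intros P \<open>polynomial_fun q0\<close>)
    moreover have "polynomial_fun (\<lambda>w. p w $ j)" for j
      unfolding p_def vector_minus_component vector_smult_component divide_inverse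
      by (intro polynomial_fun_intros P \<open>polynomial_fun q0\<close>)
    ultimately show ?thesis
      unfolding rational_map_on_def using main \<open>a \<in> V \<inter> unit_ball\<close> by blast
  qed
  ultimately show ?thesis by blast
qed

section \<open>Groups of symmetries of a map between balls\<close>

text \<open>
  Along the line of an eigenvector of \<open>X\<close> the linearised equation becomes an Euler system in one complex
  variable.
\<close>

lemma polynomial_along_eigenline:
  fixes F :: "complex ^ 'n \<Rightarrow> complex ^ 'm"
  assumes hol: "holomorphic_map_on F unit_ball"
    and XY: "\<forall>z D. norm z < 1 \<longrightarrow> (F has_derivative D) (at z) \<longrightarrow> D (X *v z) = Y *v F z"
    and v: "v \<noteq> 0" and \<mu>: "\<mu> \<noteq> 0" "X *v v = \<mu> *s v"
  obtains d c where "\<And>t. norm (t *s v) < 1 \<Longrightarrow> F (t *s v) = (\<Sum>k\<le>d. t ^ k *s c k)"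
proof -
  define R where "R = inverse (norm v)"
  have R: "0 < R" using v by (simp add: R_def)
  have ball: "t \<in> ball 0 R \<longleftrightarrow> norm (t *s v) < 1" for t
    using v by (simp add: R_def norm_scale field_simps)
  have ball_eq: "ball 0 R = {t. norm (t *s v) < 1}" using ball by blast
  define u where "u j t = F (t *s v) $ j" for j t
  have u: "u j t = herm (F (t *s v)) (axis j 1)" for j t
    by (simp add: u_def herm_def axis_def if_distrib sum.If_cases cong: if_cong)
  have u_hol: "u j holomorphic_on ball 0 R" for j
    using holomorphic_on_line[OF hol, of v "axis j 1"] unfolding ball_eq u[abs_def] .
  have ode: "\<mu> * (t * deriv (u j) t) = (\<Sum>l\<in>UNIV. Y $ j $ l * u l t)" if t: "t \<in> ball 0 R" for j t
  proof -
    have t1: "norm (t *s v) < 1" using t ball by blast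
    obtain D where D: "(F has_derivative D) (at (t *s v))" "Vector_Spaces.linear (*s) (*s) D"
      using holomorphic_map_onD[OF hol t1] .
    have "deriv (u j) t = herm (D v) (axis j 1)"
      unfolding u[abs_def] by (rule DERIV_imp_deriv[OF has_field_derivative_along_line[OF D]])
    also have "\<dots> = D v $ j"
      by (simp add: herm_def axis_def if_distrib sum.If_cases cong: if_cong)
    finally have der: "deriv (u j) t = D v $ j" .
    have "D (X *v (t *s v)) = (t * \<mu>) *s D v"
      by (simp add: vector_scalar_commute \<mu>(2) complex_linearD(2)[OF D(2)])
    then have "(t * \<mu>) *s D v = Y *v F (t *s v)" using XY t1 D(1) by metis
    then have "((t * \<mu>) *s D v) $ j = (Y *v F (t *s v)) $ j" by simp
    then show ?thesis by (simp add: der matrix_vector_mult_def u_def mult_ac)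
  qed
  obtain d c where dc: "\<And>j t. t \<in> ball 0 R \<Longrightarrow> u j t = (\<Sum>k\<le>d. t ^ k * c k $ j)"
    using Euler_system_polynomial[OF u_hol R \<mu>(1) ode] by blast
  show thesis
  proof (rule that)
    fix t assume "norm (t *s v) < 1"
    then have "t \<in> ball 0 R" using ball by blast
    then show "F (t *s v) = (\<Sum>k\<le>d. t ^ k *s c k)"
      using dc by (simp add: vec_eq_iff u_def sum_component)
  qed
qed

text \<open>
  Clearing the nonvanishing denominator of the involution turns a linear condition on its value into an
  affine condition on its argument. Its solutions form a proper affine subspace when the condition is
  nontrivial.
\<close>

lemma minimal_map_no_annihilator:
  fixes f :: "complex ^ 'n \<Rightarrow> complex ^ 'm"
  assumes min: "minimal_map f" and b: "norm b < 1"
    and ann: "\<And>w. norm w < 1 \<Longrightarrow> norm (f w) < 1 \<and> Y *v ball_involution b (f w) = 0"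
  shows "Y = 0"
proof (rule ccontr)
  assume "Y \<noteq> 0"
  define W where "W = {x. Y *v ball_involution_lin b x = 0}"
  have sub: "vec.subspace W"
    unfolding vec.subspace_def W_def
    by (auto simp: ball_involution_lin_add ball_involution_lin_scale matrix_vector_right_distrib vector_scalar_commute)
      (simp add: ball_involution_lin_def)
  obtain v where "Y *v v \<noteq> 0" using \<open>Y \<noteq> 0\<close> by (auto simp: matrix_eq)
  moreover obtain x where "ball_involution_lin b x = v" using ball_involution_lin_surj[OF b] .
  ultimately have "x \<notin> W" by (simp add: W_def)
  then have "vec.span W \<noteq> UNIV" using sub by (auto simp: vec.span_eq_iff[THEN iffD2])
  then have "vec.dim W \<noteq> CARD('m)"
    using vec.dim_eq_full[of W] vec.dim_eq_full[of "UNIV :: (complex ^ 'm) set"]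
    by (metis vec.span_UNIV vec_dim_card)
  moreover have "vec.dim W \<le> CARD('m)" by (rule dim_subset_UNIV_cart_gen)
  ultimately have dim: "vec.dim W < CARD('m)" by simp
  have "f ` unit_ball \<subseteq> (\<lambda>w. b + w) ` W"
  proof
    fix y assume "y \<in> f ` unit_ball"
    then obtain w where w: "norm w < 1" "y = f w" by auto
    then have y: "norm y < 1" "Y *v ball_involution b y = 0" using ann by auto
    then have "- inverse (1 - herm y b) *s (Y *v ball_involution_lin b (y - b)) = 0"
      by (simp add: ball_involution_eq_ball_involution_lin[OF b] vector_scalar_commute[symmetric])
    moreover have "1 - herm y b \<noteq> 0" using one_minus_herm_nonzero[of y b] y b by simp
    ultimately have "Y *v ball_involution_lin b (y - b) = 0" by simp
    then show "y \<in> (\<lambda>w. b + w) ` W" by (intro image_eqI[of _ _ "y - b"]) (auto simp: W_def)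
  qed
  then show False
    using min sub dim unfolding minimal_map_def complex_affine_dim_def by blast
qed

text \<open>
  Conjugation by the involutions at \<open>a\<close> and \<open>f a\<close> embeds the group into the unitary symmetries of
  the conjugated map \<open>F\<close>. An infinite group therefore has an infinitesimal symmetry \<open>(X, Y)\<close>; minimality
  excludes \<open>X = 0\<close>, and an eigenvector of \<open>X\<close> with a nonzero eigenvalue spans a line on which \<open>F\<close> is
  polynomial, so that \<open>f\<close> is rational on a line through \<open>a\<close>.
\<close>

lemma finite_A_grp_if_fixed_point:
  fixes f :: "complex ^ 'n \<Rightarrow> complex ^ 'm"
  assumes hol: "holomorphic_map_on f unit_ball" and maps: "\<And>z. norm z < 1 \<Longrightarrow> norm (f z) < 1"
    and min: "minimal_map f" and nr: "completely_nonrational f"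
    and a: "norm a < 1" and fix_a: "\<And>\<gamma> \<psi>. (\<gamma>, \<psi>) \<in> A_grp f \<Longrightarrow> \<gamma> a = a"
  shows "finite (A_grp f)"
proof (rule ccontr)
  assume inf: "infinite (A_grp f)"
  define b where "b = f a"
  have b: "norm b < 1" using maps[OF a] by (simp add: b_def)
  define F where "F z = ball_involution b (f (ball_involution a z))" for z
  have F_hol: "holomorphic_map_on F unit_ball"
    unfolding F_def[abs_def]
    by (intro holomorphic_map_on_compose[OF holomorphic_map_on_compose[OF holomorphic_map_on_ball_involution[OF a] hol]
          holomorphic_map_on_ball_involution[OF b]] norm_ball_involution_less_1[OF a] maps)
  have F_maps: "norm (F z) < 1" if "norm z < 1" for z
    unfolding F_def by (intro norm_ball_involution_less_1[OF b] maps norm_ball_involution_less_1[OF a] that)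
  have fF: "f w = ball_involution b (F (ball_involution a w))" if "norm w < 1" for w
    using that maps[OF that] by (simp add: F_def ball_involution_ball_involution[OF a] ball_involution_ball_involution[OF b])
  define rel where "rel p q \<longleftrightarrow>
    (\<forall>z. norm z < 1 \<longrightarrow> ball_involution a (fst p (ball_involution a z)) = fst q *v z) \<and>
    (\<forall>z. norm z < 1 \<longrightarrow> ball_involution b (snd p (ball_involution b z)) = snd q *v z)"
    for p :: "(complex ^ 'n \<Rightarrow> complex ^ 'n) \<times> (complex ^ 'm \<Rightarrow> complex ^ 'm)"
    and q :: "(complex ^ 'n ^ 'n) \<times> (complex ^ 'm ^ 'm)"
  have "\<exists>q \<in> unitary_symmetries F. rel p q" if p: "p \<in> A_grp f" for p
  proof -
    obtain \<gamma> \<psi> where p_eq: "p = (\<gamma>, \<psi>)" by (cases p)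
    have comm: "f (\<gamma> z) = \<psi> (f z)" if "norm z < 1" for z
      using p that by (auto simp: p_eq A_grp_def)
    obtain h where h: "bihol \<gamma> h" using p by (auto simp: p_eq A_grp_def ball_aut_iff)
    obtain k where k: "bihol \<psi> k" using p by (auto simp: p_eq A_grp_def ball_aut_iff)
    have \<gamma>a: "\<gamma> a = a" using fix_a p by (simp add: p_eq)
    then have \<psi>b: "\<psi> b = b" using comm[OF a] by (simp add: b_def)
    obtain A where A: "\<And>z. norm z < 1 \<Longrightarrow> ball_involution a (\<gamma> (ball_involution a z)) = A *v z" "\<And>x. norm (A *v x) = norm x"
      using bihol_fixing_0_unitary[OF bihol_compose[OF bihol_compose[OF bihol_ball_involution[OF a] h] bihol_ball_involution[OF a]]]
      by (auto simp: \<gamma>a ball_involution_self[OF a])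
    obtain B where B: "\<And>z. norm z < 1 \<Longrightarrow> ball_involution b (\<psi> (ball_involution b z)) = B *v z" "\<And>x. norm (B *v x) = norm x"
      using bihol_fixing_0_unitary[OF bihol_compose[OF bihol_compose[OF bihol_ball_involution[OF b] k] bihol_ball_involution[OF b]]]
      by (auto simp: \<psi>b ball_involution_self[OF b])
    have "F (A *v z) = B *v F z" if z: "norm z < 1" for z
    proof -
      have az: "norm (ball_involution a z) < 1" using norm_ball_involution_less_1[OF a z] .
      then have "norm (\<gamma> (ball_involution a z)) < 1" using h by (simp add: bihol_def)
      then have "F (A *v z) = ball_involution b (f (\<gamma> (ball_involution a z)))"
        by (simp add: F_def ball_involution_ball_involution[OF a] flip: A(1)[OF z])
      also have "\<dots> = ball_involution b (\<psi> (f (ball_involution a z)))" by (simp add: comm[OF az])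
      also have "f (ball_involution a z) = ball_involution b (F z)"
        using maps[OF az] by (simp add: F_def ball_involution_ball_involution[OF b])
      finally show ?thesis using B(1)[OF F_maps[OF z]] by simp
    qed
    then have "(A, B) \<in> unitary_symmetries F" using A(2) B(2) by (simp add: unitary_symmetries_def)
    moreover have "rel p (A, B)" using A(1) B(1) by (simp add: rel_def p_eq)
    ultimately show ?thesis by blast
  qed
  then obtain \<Phi> where \<Phi>: "\<And>p. p \<in> A_grp f \<Longrightarrow> \<Phi> p \<in> unitary_symmetries F \<and> rel p (\<Phi> p)"
    by metis
  \<comment> \<open>An automorphism is recovered from its conjugate because the involutions are injective and its values off the ball are prescribed.\<close>
  have aut_eq: "\<gamma> = \<gamma>'"
    if "\<gamma> \<in> ball_aut" "\<gamma>' \<in> ball_aut" "norm c < 1"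
      "\<And>z. norm z < 1 \<Longrightarrow> ball_involution c (\<gamma> (ball_involution c z)) = A *v z"
      "\<And>z. norm z < 1 \<Longrightarrow> ball_involution c (\<gamma>' (ball_involution c z)) = A *v z"
    for \<gamma> \<gamma>' c and A :: "complex ^ 'k ^ 'k"
  proof (rule extensionalityI)
    show "\<gamma> \<in> extensional unit_ball" "\<gamma>' \<in> extensional unit_ball"
      using that by (auto simp: ball_aut_iff)
    fix z :: "complex ^ 'k" assume "z \<in> unit_ball"
    then have z: "norm z < 1" by simp
    then have "norm (\<gamma> z) < 1" "norm (\<gamma>' z) < 1"
      using that(1,2) by (auto simp: ball_aut_iff bihol_def)
    moreover have "ball_involution c (\<gamma> z) = ball_involution c (\<gamma>' z)"
      using that(4,5)[OF norm_ball_involution_less_1[OF that(3) z]] z by (simp add: ball_involution_ball_involution[OF that(3)])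
    ultimately show "\<gamma> z = \<gamma>' z"
      using ball_involution_ball_involution[OF that(3)] by (metis less_imp_le)
  qed
  have "inj_on \<Phi> (A_grp f)"
  proof (rule inj_onI)
    fix p p' assume p: "p \<in> A_grp f" "p' \<in> A_grp f" "\<Phi> p = \<Phi> p'"
    have "rel p (\<Phi> p)" "rel p' (\<Phi> p)" using \<Phi>[OF p(1)] \<Phi>[OF p(2)] p(3) by auto
    moreover have "fst p \<in> ball_aut" "fst p' \<in> ball_aut" "snd p \<in> ball_aut" "snd p' \<in> ball_aut"
      using p by (auto simp: A_grp_def)
    ultimately have "fst p = fst p'" "snd p = snd p'"
      using aut_eq[OF _ _ a, of "fst p" "fst p'" "fst (\<Phi> p)"] aut_eq[OF _ _ b, of "snd p" "snd p'" "snd (\<Phi> p)"]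
      by (auto simp: rel_def)
    then show "p = p'" by (rule prod_eqI)
  qed
  then have "infinite (\<Phi> ` A_grp f)" using inf finite_imageD by blast
  moreover have "\<Phi> ` A_grp f \<subseteq> unitary_symmetries F" using \<Phi> by blast
  ultimately have "infinite (unitary_symmetries F)" using finite_subset by blast
  then obtain X Y where XY0: "(X, Y) \<noteq> 0" and skew: "\<And>x. inner (X *v x) x = 0"
    and XY: "\<And>z D. norm z < 1 \<Longrightarrow> (F has_derivative D) (at z) \<Longrightarrow> D (X *v z) = Y *v F z"
    using infinitesimal_symmetry by blast
  have "X \<noteq> 0"
  proof
    assume "X = 0"
    have "Y *v F z = 0" if z: "norm z < 1" for z
    proof -
      obtain D where D: "(F has_derivative D) (at z)" "Vector_Spaces.linear (*s) (*s) D"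
        using holomorphic_map_onD[OF F_hol z] .
      have "D 0 = 0" using complex_linearD(2)[OF D(2), of 0 0] by simp
      then show ?thesis using XY[OF z D(1)] \<open>X = 0\<close> by simp
    qed
    from this[OF norm_ball_involution_less_1[OF a]]
    have "norm (f w) < 1 \<and> Y *v ball_involution b (f w) = 0" if "norm w < 1" for w
      using that maps[OF that] by (simp add: F_def ball_involution_ball_involution[OF a])
    then have "Y = 0" by (rule minimal_map_no_annihilator[OF min b])
    then show False using XY0 \<open>X = 0\<close> by (simp add: zero_prod_def)
  qed
  then obtain v M where v: "v \<noteq> 0" "M \<noteq> 0" "X *v v = (\<i> * complex_of_real M) *s v"
    using skew_matrix_eigenvector[OF skew] by blast
  have "\<i> * complex_of_real M \<noteq> 0" using v(2) by simp
  moreover have "\<forall>z D. norm z < 1 \<longrightarrow> (F has_derivative D) (at z) \<longrightarrow> D (X *v z) = Y *v F z"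
    using XY by blast
  ultimately obtain d c where pol: "\<And>t. norm (t *s v) < 1 \<Longrightarrow> F (t *s v) = (\<Sum>k\<le>d. t ^ k *s c k)"
    using polynomial_along_eigenline[OF F_hol _ v(1) _ v(3)] by metis
  obtain V where "complex_affine_dim V 1" "V \<inter> unit_ball \<noteq> {}" "rational_map_on f (V \<inter> unit_ball)"
    using rational_on_line[where F = F and c = c, OF a b v(1) F_maps pol fF] by blast
  then show False using nr unfolding completely_nonrational_def by (metis zero_less_one)
qed

lemma restrict_id_ball_aut: "restrict (\<lambda>z. z) unit_ball \<in> ball_aut"
proof (rule bihol_restrict)
  show "bihol (\<lambda>z. z) (\<lambda>z. z)"
    unfolding bihol_def holomorphic_map_on_def
    by (auto intro!: exI[of _ "\<lambda>z. z"] complex_linearI has_derivative_ident)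
qed

lemma A_grp_identity:
  assumes "\<And>z. norm z < 1 \<Longrightarrow> norm (f z) < 1"
  shows "(restrict (\<lambda>z. z) unit_ball, restrict (\<lambda>z. z) unit_ball) \<in> A_grp f"
  using assms by (simp add: A_grp_def restrict_id_ball_aut)

lemma A_grp_divide:
  fixes f :: "complex ^ 'n \<Rightarrow> complex ^ 'm"
  assumes maps: "\<And>z. norm z < 1 \<Longrightarrow> norm (f z) < 1"
    and p: "(\<gamma>, \<psi>) \<in> A_grp f" and p': "(\<gamma>', \<psi>') \<in> A_grp f" and z: "norm z < 1"
  obtains \<delta> \<theta> where "(\<delta>, \<theta>) \<in> A_grp f" "\<gamma> (\<delta> z) = \<gamma>' z" "norm (\<delta> z) < 1"
proof -
  obtain h k where h: "bihol \<gamma> h" and k: "bihol \<psi> k" using p by (auto simp: A_grp_def ball_aut_iff)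
  obtain h' k' where h': "bihol \<gamma>' h'" and k': "bihol \<psi>' k'" using p' by (auto simp: A_grp_def ball_aut_iff)
  have comm: "f (\<gamma> z) = \<psi> (f z)" and comm': "f (\<gamma>' z) = \<psi>' (f z)" if "norm z < 1" for z
    using p p' that by (auto simp: A_grp_def)
  define \<delta> where "\<delta> = restrict (\<lambda>z. h (\<gamma>' z)) unit_ball"
  define \<theta> where "\<theta> = restrict (\<lambda>z. k (\<psi>' z)) unit_ball"
  have "\<delta> \<in> ball_aut" "\<theta> \<in> ball_aut"
    unfolding \<delta>_def \<theta>_def
    using bihol_restrict[OF bihol_compose[OF h' bihol_sym[OF h]]]
      bihol_restrict[OF bihol_compose[OF k' bihol_sym[OF k]]] by auto
  moreover have "f (\<delta> z) = \<theta> (f z)" if z: "norm z < 1" for z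
  proof -
    have 1: "norm (\<gamma>' z) < 1" "norm (h (\<gamma>' z)) < 1" "\<gamma> (h (\<gamma>' z)) = \<gamma>' z"
      using h h' z by (auto simp: bihol_def)
    have "\<psi> (f (h (\<gamma>' z))) = \<psi>' (f z)" using comm[OF 1(2)] comm'[OF z] 1(3) by simp
    then have "k (\<psi> (f (h (\<gamma>' z)))) = k (\<psi>' (f z))" by simp
    then have "f (h (\<gamma>' z)) = k (\<psi>' (f z))" using k maps[OF 1(2)] by (auto simp: bihol_def)
    then show ?thesis using z maps[OF z] by (simp add: \<delta>_def \<theta>_def)
  qed
  ultimately have "(\<delta>, \<theta>) \<in> A_grp f" by (auto simp: A_grp_def)
  moreover have "\<gamma> (\<delta> z) = \<gamma>' z" "norm (\<delta> z) < 1"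
    using h h' z by (auto simp: bihol_def \<delta>_def)
  ultimately show thesis using that by blast
qed

lemma compact_subset_unit_ball_bounded_away:
  fixes K :: "(complex ^ 'n) set"
  assumes "compact K" "K \<subseteq> unit_ball"
  obtains r where "r < 1" "K \<subseteq> cball 0 r"
proof (cases "K = {}")
  case False
  then obtain x where x: "x \<in> K" "\<And>y. y \<in> K \<Longrightarrow> norm y \<le> norm x"
    using continuous_attains_sup[OF assms(1) False continuous_on_norm_id] by blast
  show thesis
  proof (rule that)
    show "norm x < 1" using x(1) assms(2) by auto
    show "K \<subseteq> cball 0 (norm x)" using x(2) by auto
  qed
qed (use that[of 0] in auto)

lemma compact_evaluation:
  fixes G :: "(complex ^ 'n \<Rightarrow> complex ^ 'n) set"
  assumes G: "compactin ball_aut_topology G" and p: "norm p < 1"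
  obtains r where "r < 1" "\<And>g. g \<in> G \<Longrightarrow> norm (g p) \<le> r"
proof -
  have "continuous_map ball_aut_topology euclidean (\<lambda>g. g p)"
    unfolding continuous_map_def
  proof (intro conjI allI impI)
    fix U :: "(complex ^ 'n) set" assume "openin euclidean U"
    then have U: "open U" by simp
    have "{g \<in> topspace ball_aut_topology. g p \<in> U} = {g \<in> ball_aut. g ` {p} \<subseteq> U}"
      by (auto simp: topspace_ball_aut_topology)
    moreover have "openin ball_aut_topology {g \<in> ball_aut. g ` {p} \<subseteq> U}"
      unfolding ball_aut_topology_def
    proof (rule topology_generated_by_Basis, rule CollectI, intro exI conjI)
      show "{g \<in> ball_aut. g ` {p} \<subseteq> U} = {g \<in> ball_aut. g ` {p} \<subseteq> U}" by (rule refl)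
    qed (use p U in auto)
    ultimately show "openin ball_aut_topology {g \<in> topspace ball_aut_topology. g p \<in> U}" by simp
  qed auto
  then have "compact ((\<lambda>g. g p) ` G)"
    using image_compactin[OF G] by (metis compactin_euclidean_iff)
  moreover have "G \<subseteq> ball_aut" using compactin_subset_topspace[OF G] topspace_ball_aut_topology by blast
  then have "(\<lambda>g. g p) ` G \<subseteq> unit_ball" using p by (force simp: ball_aut_iff bihol_def)
  ultimately obtain r where "r < 1" "(\<lambda>g. g p) ` G \<subseteq> cball 0 r"
    using compact_subset_unit_ball_bounded_away by blast
  show thesis
  proof (rule that)
    show "r < 1" by fact
    show "norm (g p) \<le> r" if "g \<in> G" for g using \<open>_ \<subseteq> cball 0 r\<close> that by auto
  qed
qed

lemma finite_A_grp_if_bounded_orbit: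
  fixes f :: "complex ^ 'n \<Rightarrow> complex ^ 'm"
  assumes hol: "holomorphic_map_on f unit_ball" and maps: "\<And>z. norm z < 1 \<Longrightarrow> norm (f z) < 1"
    and min: "minimal_map f" and nr: "completely_nonrational f"
    and r: "r < 1" "\<And>\<gamma>. \<gamma> \<in> Gamma_grp f \<Longrightarrow> norm (\<gamma> 0) \<le> r"
  shows "finite (A_grp f)"
proof -
  define S where "S = (\<lambda>\<gamma>. \<gamma> 0) ` Gamma_grp f"
  have "S \<subseteq> cball 0 r" using r by (auto simp: S_def)
  moreover have "0 \<in> S"
    unfolding S_def Gamma_grp_def using imageI[OF imageI[OF A_grp_identity[of f], of fst], of "\<lambda>\<gamma>. \<gamma> 0"] maps by simp
  ultimately obtain a where a: "norm a < 1" "\<And>g h. bihol g h \<Longrightarrow> S \<subseteq> g ` S \<Longrightarrow> g a = a"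
    using hyperbolic_circumcentre[OF _ r(1)] by blast
  show ?thesis
  proof (rule finite_A_grp_if_fixed_point[OF hol maps min nr a(1)])
    fix \<gamma> \<psi> assume p: "(\<gamma>, \<psi>) \<in> A_grp f"
    then obtain h where h: "bihol \<gamma> h" by (auto simp: A_grp_def ball_aut_iff)
    have "S \<subseteq> \<gamma> ` S"
    proof
      fix y assume "y \<in> S"
      then obtain \<gamma>' \<psi>' where p': "(\<gamma>', \<psi>') \<in> A_grp f" "y = \<gamma>' 0" by (auto simp: S_def Gamma_grp_def)
      obtain \<delta> \<theta> where "(\<delta>, \<theta>) \<in> A_grp f" "\<gamma> (\<delta> 0) = \<gamma>' 0"
        by (rule A_grp_divide[OF maps p p'(1), of 0]) auto
      then show "y \<in> \<gamma> ` S" by (force simp: S_def Gamma_grp_def p'(2))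
    qed
    then show "\<gamma> a = a" using a(2)[OF h] by blast
  qed
qed

theorem theorem1p3:
  fixes f :: "complex ^ 'n \<Rightarrow> complex ^ 'm"
  assumes "proper_holomorphic_map f"
    and "minimal_map f"
    and "completely_nonrational f"
  shows "(finite (Gamma_grp f) \<and> finite (T_grp f)) \<or>
    (\<not> compactin ball_aut_topology (Gamma_grp f) \<and> \<not> compactin ball_aut_topology (T_grp f))"
proof -
  have hol: "holomorphic_map_on f unit_ball" and "f ` unit_ball \<subseteq> unit_ball"
    and proper: "\<And>K. compact K \<Longrightarrow> K \<subseteq> unit_ball \<Longrightarrow> compact {z \<in> unit_ball. f z \<in> K}"
    using assms(1) unfolding proper_holomorphic_map_iff by blast+
  then have maps: "norm (f z) < 1" if "norm z < 1" for z
    using that by (simp add: image_subset_iff)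
  have "finite (A_grp f)" if "compactin ball_aut_topology (Gamma_grp f) \<or> compactin ball_aut_topology (T_grp f)"
    using that
  proof
    assume G: "compactin ball_aut_topology (Gamma_grp f)"
    obtain r where r: "r < 1" "\<And>\<gamma>. \<gamma> \<in> Gamma_grp f \<Longrightarrow> norm (\<gamma> 0) \<le> r"
      by (rule compact_evaluation[OF G, of 0]) auto
    show "finite (A_grp f)"
      by (rule finite_A_grp_if_bounded_orbit[OF hol _ assms(2,3), where r = r]) (use maps r in auto)
  next
    assume T: "compactin ball_aut_topology (T_grp f)"
    have "norm (f 0) < 1" using maps[of 0] by simp
    then obtain s where s: "s < 1" "\<And>\<psi>. \<psi> \<in> T_grp f \<Longrightarrow> norm (\<psi> (f 0)) \<le> s"
      using compact_evaluation[OF T] by blast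
    \<comment> \<open>Since \<open>f (\<gamma> 0) = \<psi> (f 0)\<close>, properness transfers the bound on the orbit of \<open>f 0\<close> to the orbit of \<open>0\<close>.\<close>
    have "compact {z \<in> unit_ball. f z \<in> cball 0 s}"
      by (rule proper) (use s(1) in auto)
    then obtain r where r: "r < 1" "{z \<in> unit_ball. f z \<in> cball 0 s} \<subseteq> cball 0 r"
      by (rule compact_subset_unit_ball_bounded_away) auto
    have bound: "norm (\<gamma> 0) \<le> r" if \<gamma>: "\<gamma> \<in> Gamma_grp f" for \<gamma>
    proof -
      obtain \<psi> where p: "(\<gamma>, \<psi>) \<in> A_grp f" using \<gamma> by (auto simp: Gamma_grp_def)
      have "norm (\<gamma> 0) < 1" using p by (auto simp: A_grp_def ball_aut_iff bihol_def)
      moreover have "\<psi> \<in> T_grp f" using p by (force simp: T_grp_def)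
      then have "norm (f (\<gamma> 0)) \<le> s" using s(2) p by (auto simp: A_grp_def)
      ultimately show ?thesis using r(2) by auto
    qed
    show "finite (A_grp f)"
      by (rule finite_A_grp_if_bounded_orbit[OF hol _ assms(2,3), where r = r]) (use maps r(1) bound in auto)
  qed
  then show ?thesis by (auto simp: Gamma_grp_def T_grp_def)
qed

end
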